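(* Let $n,d,L$ be positive integers. There exists a bijection $\Phi$ from the set of permutations $\pi\in S_n$ that avoid both patterns $d\cdots 1(d+1)$ and $1\cdots(L+1)$ to the set of pairs $(P,Q)$ of $(d,L)$-cylindric standard Young tableaux of size $n$ with $\mathrm{sh}(P)=\mathrm{sh}(Q)$. Moreover, if $\Phi(\pi)=(P,Q)$ then $\Phi(\pi^{-1})=(Q,P)$.
   Context: A permutation $\pi\in S_n$ (in one-line notation $\pi(1)\cdots\pi(n)$) avoids the pattern $1\cdots(L+1)$ if it has no increasing subsequence of length $L+1$. It avoids $d\cdots 1(d+1)$ if there are no indices $i_1<\dots<i_d<i_{d+1}$ with $\pi(i_1)>\pi(i_2)>\dots>\pi(i_d)$ and $\pi(i_{d+1})>\pi(i_1)$. A partition $\lambda=(\lambda_1\ge\lambda_2\ge\cdots)$ is a finite weakly decreasing sequence of positive integers, with the convention $\lambda_i=0$ for $i$ beyond its length $\ell(\lambda)$; $|\lambda|=\sum_i\lambda_i$. A $d$-partition is a partition with $\ell(\lambda)\le d$. For $d$-partitions $\alpha,\beta$ write $\alpha\prec_{(d,L)}\beta$ if $\beta_1\ge\alpha_1\ge\beta_2\ge\alpha_2\ge\cdots\ge\beta_d\ge\alpha_d\ge\beta_1-L$. A $(d,L)$-cylindric standard Young tableau of size $n$ is a sequence of $d$-partitions $\emptyset=\lambda^{(0)}\prec_{(d,L)}\lambda^{(1)}\prec_{(d,L)}\cdots\prec_{(d,L)}\lambda^{(n)}$ with $|\lambda^{(i)}|-|\lambda^{(i-1)}|=1$ for all $i$;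 its shape is $\mathrm{sh}(T)=\lambda^{(n)}$. *)

theory Defs
  imports "HOL-Combinatorics.Permutations"
begin

text \<open>Permutations of {1..n} are functions nat => nat with p permutes {1..n};
  one-line notation p(1) ... p(n). Positions are 1..n.\<close>

definition avoids_incr :: "nat \<Rightarrow> nat \<Rightarrow> (nat \<Rightarrow> nat) \<Rightarrow> bool" where
  "avoids_incr n L p \<longleftrightarrow>
     \<not> (\<exists>is. length is = L + 1 \<and> set is \<subseteq> {1..n} \<and> sorted_wrt (<) is
            \<and> sorted_wrt (<) (map p is))"

definition avoids_dec_then_up :: "nat \<Rightarrow> nat \<Rightarrow> (nat \<Rightarrow> nat) \<Rightarrow> bool" where
  "avoids_dec_then_up n d p \<longleftrightarrow>
     \<not> (\<exists>is. length is = d + 1 \<and> set is \<subseteq> {1..n} \<and> sorted_wrt (<) is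
            \<and> sorted_wrt (>) (map p (take d is)) \<and> p (is ! d) > p (is ! 0))"

definition avoiders :: "nat \<Rightarrow> nat \<Rightarrow> nat \<Rightarrow> (nat \<Rightarrow> nat) set" where
  "avoiders n d L = {p. p permutes {1..n} \<and> avoids_dec_then_up n d p \<and> avoids_incr n L p}"

text \<open>A d-partition is represented as the list [lambda_1, ..., lambda_d] of length d
  (weakly decreasing, zero-padded).\<close>
definition dpart :: "nat \<Rightarrow> nat list \<Rightarrow> bool" where
  "dpart d lam \<longleftrightarrow> length lam = d \<and> sorted_wrt (\<ge>) lam"

definition size_part :: "nat list \<Rightarrow> nat" where
  "size_part lam = sum_list lam"

definition cyl_prec :: "nat \<Rightarrow> nat \<Rightarrow> nat list \<Rightarrow> nat list \<Rightarrow> bool" where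
  "cyl_prec d L alpha beta \<longleftrightarrow>
     (\<forall>i<d. alpha ! i \<le> beta ! i) \<and>
     (\<forall>i. i + 1 < d \<longrightarrow> beta ! (i + 1) \<le> alpha ! i) \<and>
     int (alpha ! (d - 1)) \<ge> int (beta ! 0) - int L"

definition cylSYT :: "nat \<Rightarrow> nat \<Rightarrow> nat \<Rightarrow> nat list list set" where
  "cylSYT n d L = {T. length T = n + 1 \<and> (\<forall>i\<le>n. dpart d (T ! i)) \<and>
      T ! 0 = replicate d 0 \<and>
      (\<forall>i<n. cyl_prec d L (T ! i) (T ! (i + 1)) \<and>
              size_part (T ! (i + 1)) = size_part (T ! i) + 1)}"

definition shape :: "nat list list \<Rightarrow> nat list" where
  "shape T = last T"

end

theory Submission
  imports Defs
begin

text \<open>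
  The bijection is given by growth diagrams with a cyclic local rule. Put a cross at each
  \<^term>\<open>(x, p x)\<close> and label the lattice points by \<open>d\<close>-partitions, with
  zero on the left and bottom boundary. In a square with lower left label \<open>a\<close>, if both
  neighbours of \<open>a\<close> arise by adding a box in the same row, the fourth corner gets a further
  box in the cyclically next row; a cross adds a box in the first row. On cylindric partitions
  this rule can be inverted exactly when crosses are restricted to squares whose lower left label
  has last part zero and first part less than \<open>L\<close>. Hence pairs of tableaux of the same shape,
  read off the right and top boundary, correspond to the permutations all of whose crosses are
  admissible, and transposing the diagram inverts the permutation.

  As long as the last part is zero, no box wraps around, and the diagram is an ordinary
  Robinson-Schensted growth diagram. By Schensted's theorem the first part is then the length of a
  longest increasing chain, and the last part is zero iff there is no decreasing chain of length
  \<open>d\<close> to the lower left. So all crosses are admissible iff both patterns are avoided.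
\<close>

section \<open>Shadows and longest chains\<close>

text \<open>On a partial permutation this is the length of a longest increasing chain: at a point of
  \<open>S\<close> the three other corners of the square have equal values, so adding one to the
  maximum is the usual recursion. In this form it is also the growth rule of the first row.\<close>

fun rk :: "(nat \<Rightarrow> nat \<Rightarrow> bool) \<Rightarrow> nat \<Rightarrow> nat \<Rightarrow> nat" where
  "rk S 0 j = 0"
| "rk S (Suc i) 0 = 0"
| "rk S (Suc i) (Suc j) = max (rk S i (Suc j)) (rk S (Suc i) j) + of_bool (S (Suc i) (Suc j))"

text \<open>
  Viennot's shadow: the points where a row of the growth diagram passes a box on to the next row.
\<close>

definition shadow :: "(nat \<Rightarrow> nat \<Rightarrow> bool) \<Rightarrow> nat \<Rightarrow> nat \<Rightarrow> bool" where
  "shadow S x y \<longleftrightarrow> 0 < x \<and> 0 < y \<and>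
     rk S (x - 1) (y - 1) < rk S x (y - 1) \<and> rk S (x - 1) (y - 1) < rk S (x - 1) y"

text \<open>Partial, because passing to the shadow loses points. A point is named by the upper right
  corner of its unit square, hence the positive coordinates.\<close>

definition partial_perm :: "(nat \<Rightarrow> nat \<Rightarrow> bool) \<Rightarrow> bool" where
  "partial_perm S \<longleftrightarrow>
     (\<forall>x y. S x y \<longrightarrow> 0 < x \<and> 0 < y) \<and>
     (\<forall>x y y'. S x y \<longrightarrow> S x y' \<longrightarrow> y = y') \<and>
     (\<forall>x x' y. S x y \<longrightarrow> S x' y \<longrightarrow> x = x')"

lemma rk_0_right [simp]: "rk S i 0 = 0"
  by (cases i) auto

lemma rk_transpose: "rk (\<lambda>x y. S y x) i j = rk S j i"
  by (induction S j i rule: rk.induct) (auto simp: max.commute)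

lemma shadow_transpose: "shadow (\<lambda>x y. S y x) = (\<lambda>x y. shadow S y x)"
  by (auto simp: shadow_def rk_transpose[of S] fun_eq_iff)

lemma partial_perm_transpose: "partial_perm S \<Longrightarrow> partial_perm (\<lambda>x y. S y x)"
  unfolding partial_perm_def by blast

lemma rk_le_Suc_left: "rk S i j \<le> rk S (Suc i) j"
  by (cases j) auto

lemma rk_le_Suc_right: "rk S i j \<le> rk S i (Suc j)"
  by (cases i) auto

lemma rk_mono: "i \<le> i' \<Longrightarrow> j \<le> j' \<Longrightarrow> rk S i j \<le> rk S i' j'"
  using lift_Suc_mono_le[of "\<lambda>i. rk S i j" i i'] lift_Suc_mono_le[of "\<lambda>j. rk S i' j" j j']
    rk_le_Suc_left rk_le_Suc_right
  by (metis order_trans)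

text \<open>Increments travel through squares. A point of \<open>S\<close> creates one on edges that
  were flat, since its row and column hold no other point; elsewhere an incoming increment is passed
  on or vanishes. The two directions need each other, so \<open>col\<close> and \<open>row\<close>
  are proved together.\<close>

lemma rk_step:
  assumes S: "partial_perm S"
  shows "rk S (Suc i) j \<le> Suc (rk S i j)"
    and "rk S i j < rk S (Suc i) j \<Longrightarrow> \<exists>y\<le>j. S (Suc i) y"
    and "rk S i (Suc j) \<le> Suc (rk S i j)"
    and "rk S i j < rk S i (Suc j) \<Longrightarrow> \<exists>x\<le>i. S x (Suc j)"
proof -
  define col where "col i j \<longleftrightarrow> rk S (Suc i) j \<le> Suc (rk S i j) \<and>
     (rk S i j < rk S (Suc i) j \<longrightarrow> (\<exists>y\<le>j. S (Suc i) y))" for i j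
  define row where "row i j \<longleftrightarrow> rk S i (Suc j) \<le> Suc (rk S i j) \<and>
     (rk S i j < rk S i (Suc j) \<longrightarrow> (\<exists>x\<le>i. S x (Suc j)))" for i j
  have sq: "col i (Suc j) \<and> row (Suc i) j" if "col i j" "row i j" for i j
  proof (cases "S (Suc i) (Suc j)")
    case True
    then have "\<not> (\<exists>y\<le>j. S (Suc i) y)" "\<not> (\<exists>x\<le>i. S x (Suc j))"
      using S unfolding partial_perm_def by (metis Suc_n_not_le_n)+
    then have "rk S (Suc i) j \<le> rk S i j" "rk S i (Suc j) \<le> rk S i j"
      using that unfolding col_def row_def by auto
    then show ?thesis
      using True rk_le_Suc_left[of S i j] rk_le_Suc_right[of S i j]
      unfolding col_def row_def by auto
  next
    case False
    then show ?thesis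
      using that rk_le_Suc_left[of S i j] rk_le_Suc_right[of S i j]
      unfolding col_def row_def by (auto simp: max_def not_le intro: le_SucI)
  qed
  have col0: "col i 0" for i unfolding col_def by simp
  have row: "row i j" for i j
  proof (induction i arbitrary: j)
    case 0
    show ?case unfolding row_def by simp
  next
    case (Suc i)
    have "col i j" for j
      by (induction j) (use col0 sq Suc in auto)
    then show ?case using sq Suc by blast
  qed
  have col: "col i j" for i j
    by (induction j) (use col0 sq row in auto)
  show "rk S (Suc i) j \<le> Suc (rk S i j)"
    and "rk S i j < rk S (Suc i) j \<Longrightarrow> \<exists>y\<le>j. S (Suc i) y"
    and "rk S i (Suc j) \<le> Suc (rk S i j)"
    and "rk S i j < rk S i (Suc j) \<Longrightarrow> \<exists>x\<le>i. S x (Suc j)"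
    using col[of i j] row[of i j] unfolding col_def row_def by auto
qed

lemma rk_at_point:
  assumes "partial_perm S" "S (Suc i) (Suc j)"
  shows "rk S (Suc i) (Suc j) = Suc (rk S i j)"
proof -
  have "\<not> (\<exists>y\<le>j. S (Suc i) y)" "\<not> (\<exists>x\<le>i. S x (Suc j))"
    using assms unfolding partial_perm_def by (metis Suc_n_not_le_n)+
  then have "rk S (Suc i) j \<le> rk S i j" "rk S i (Suc j) \<le> rk S i j"
    using rk_step(2,4)[OF assms(1)] by (meson not_le)+
  then show ?thesis
    using assms(2) rk_le_Suc_left[of S i j] rk_le_Suc_right[of S i j] by auto
qed

text \<open>Descending in column \<open>Suc i\<close>, the value and the increment both survive
  until a point is met.\<close>

lemma point_below:
  assumes "rk S i j < rk S (Suc i) j"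
  shows "\<exists>y\<le>j. S (Suc i) y \<and> rk S (Suc i) y = rk S (Suc i) j"
  using assms
proof (induction j)
  case 0
  then show ?case by simp
next
  case (Suc j)
  show ?case
  proof (cases "S (Suc i) (Suc j)")
    case True
    then show ?thesis by blast
  next
    case False
    then have eq: "rk S (Suc i) (Suc j) = rk S (Suc i) j" and "rk S i j < rk S (Suc i) j"
      using Suc.prems rk_le_Suc_right[of S i j] by (auto simp: max_def split: if_splits)
    then show ?thesis using Suc.IH le_SucI by metis
  qed
qed

text \<open>In Viennot's picture the points of equal rank are joined by a zigzag line, and a shadow
  point is a corner of it: the line continues to one point of \<open>S\<close> straight below and to
  another straight to the left.\<close>

lemma shadow_point_below:
  assumes "partial_perm S" "shadow S x y"
  shows "\<exists>b<y. S x b \<and> rk S x b = Suc (rk S (x - 1) (y - 1))"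
proof -
  obtain i j where [simp]: "x = Suc i" "y = Suc j"
    using assms(2) unfolding shadow_def by (metis Suc_pred)
  have lt: "rk S i j < rk S (Suc i) j" using assms(2) by (simp add: shadow_def)
  then have "rk S (Suc i) j = Suc (rk S i j)" using rk_step(1)[OF assms(1), of i j] by simp
  then show ?thesis using point_below[OF lt] by (auto simp: less_Suc_eq_le)
qed

lemma shadow_point_left:
  assumes "partial_perm S" "shadow S x y"
  shows "\<exists>l<x. S l y \<and> rk S l y = Suc (rk S (x - 1) (y - 1))"
  using shadow_point_below[OF partial_perm_transpose[OF assms(1)], of y x] assms(2)
  by (simp add: shadow_transpose[of S] rk_transpose[of S])

text \<open>Two shadow points in a column have the same point of \<open>S\<close> below them, hence
  equal ranks at their lower left corners. But the rank in column \<open>x - 1\<close> already rises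
  on passing the lower of the two.\<close>

lemma shadow_column_unique:
  assumes S: "partial_perm S" and y: "shadow S x y" and y': "shadow S x y'"
  shows "y' \<le> y"
proof (rule ccontr)
  assume "\<not> y' \<le> y"
  obtain b where b: "b < y" "S x b" "rk S x b = Suc (rk S (x - 1) (y - 1))"
    using shadow_point_below[OF S y] by blast
  obtain b' where b': "S x b'" "rk S x b' = Suc (rk S (x - 1) (y' - 1))"
    using shadow_point_below[OF S y'] by blast
  have "b = b'" using S b(2) b'(1) unfolding partial_perm_def by blast
  then have "rk S (x - 1) (y - 1) = rk S (x - 1) (y' - 1)" using b b' by simp
  moreover have "rk S (x - 1) (y - 1) < rk S (x - 1) y" using y by (simp add: shadow_def)
  moreover have "rk S (x - 1) y \<le> rk S (x - 1) (y' - 1)"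
    using \<open>\<not> y' \<le> y\<close> by (intro rk_mono) auto
  ultimately show False by simp
qed

lemma partial_perm_shadow:
  assumes "partial_perm S"
  shows "partial_perm (shadow S)"
proof -
  have "y = y'" if "shadow S x y" "shadow S x y'" for x y y'
    using shadow_column_unique[OF assms] that by (simp add: order_antisym)
  moreover have "x = x'" if "shadow S x y" "shadow S x' y" for x x' y
    using shadow_column_unique[OF partial_perm_transpose[OF assms]] that
    by (simp add: shadow_transpose[of S] order_antisym)
  moreover have "0 < x \<and> 0 < y" if "shadow S x y" for x y
    using that by (simp add: shadow_def)
  ultimately show ?thesis unfolding partial_perm_def by blast
qed

text \<open>Either the point below the first shadow point or the point left of the second lies in
  the rectangle. The half-open bounds make the points found between successive shadow points
  strictly ordered.\<close>

lemma point_between_shadow_points: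
  assumes S: "partial_perm S" and p: "shadow S x y" and q: "shadow S x' y'"
    and "x < x'" "y' < y"
  shows "\<exists>s t. S s t \<and> x \<le> s \<and> s < x' \<and> y' \<le> t \<and> t < y"
proof -
  obtain b where b: "b < y" "S x b" "rk S x b = Suc (rk S (x - 1) (y - 1))"
    using shadow_point_below[OF S p] by blast
  obtain l where l: "l < x'" "S l y'" "rk S l y' = Suc (rk S (x' - 1) (y' - 1))"
    using shadow_point_left[OF S q] by blast
  \<comment> \<open>Otherwise each of the points \<open>(x, b)\<close> and \<open>(l, y')\<close> would have smaller rank than the other.\<close>
  have "x \<le> l \<or> y' \<le> b"
  proof (rule ccontr)
    assume "\<not> ?thesis"
    then have "rk S l y' \<le> rk S (x - 1) (y - 1)" "rk S x b \<le> rk S (x' - 1) (y' - 1)"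
      using assms(4,5) by (auto intro!: rk_mono)
    then show False using b(3) l(3) by simp
  qed
  then show ?thesis using b l assms(4,5) by blast
qed

text \<open>An increment across a column can be lost on the way up only if the rank on its left side
  rises as well, which is what a shadow point is.\<close>

lemma increment_persists:
  assumes "rk S i y < rk S (Suc i) y" "y \<le> y'"
    and "\<And>t. y < t \<Longrightarrow> t \<le> y' \<Longrightarrow> \<not> shadow S (Suc i) t"
  shows "rk S i y' < rk S (Suc i) y'"
  using assms(2,1,3)
proof (induction y' rule: dec_induct)
  case base
  then show ?case by blast
next
  case (step m)
  then have "rk S i m < rk S (Suc i) m" by simp
  moreover have "\<not> shadow S (Suc i) (Suc m)" using step by auto
  ultimately have "rk S i (Suc m) \<le> rk S i m" by (auto simp: shadow_def)
  then show ?case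
    using \<open>rk S i m < rk S (Suc i) m\<close> rk_le_Suc_right[of S "Suc i" m] by linarith
qed

lemma increment_persists_to_right:
  assumes "rk S x j < rk S x (Suc j)" "x \<le> x'"
    and "\<And>t. x < t \<Longrightarrow> t \<le> x' \<Longrightarrow> \<not> shadow S t (Suc j)"
  shows "rk S x' j < rk S x' (Suc j)"
  using increment_persists[of "\<lambda>x y. S y x" j x x'] assms
  by (simp add: shadow_transpose[of S] rk_transpose[of S])

text \<open>The lower right point sends an increment up its column, the upper left one sends an
  increment along its row. With no shadow point in between, both would arrive at the square where
  column and row cross.\<close>

lemma shadow_point_between_points:
  assumes S: "partial_perm S" and p: "S x1 y1" and q: "S x2 y2" and "x1 < x2" "y2 < y1"
  shows "\<exists>x y. shadow S x y \<and> x1 < x \<and> x \<le> x2 \<and> y2 < y \<and> y \<le> y1"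
proof (rule ccontr)
  assume none: "\<not> ?thesis"
  obtain i k j l where [simp]: "x2 = Suc i" "y2 = Suc k" "y1 = Suc j" "x1 = Suc l"
    using S p q unfolding partial_perm_def by (metis Suc_pred)
  have "rk S i (Suc k) < rk S (Suc i) (Suc k)" "rk S (Suc l) j < rk S (Suc l) (Suc j)"
    using p q by (auto simp: less_Suc_eq_le)
  moreover have "\<not> shadow S (Suc i) t" if "Suc k < t" "t \<le> Suc j" for t
    using none that assms(4) by auto
  moreover have "\<not> shadow S t (Suc j)" if "Suc l < t" "t \<le> Suc i" for t
    using none that assms(5) by auto
  \<comment> \<open>The corner would exceed both of its neighbours, although without a point there
    its value is their maximum.\<close>
  ultimately have "rk S i (Suc j) < rk S (Suc i) (Suc j)" "rk S (Suc i) j < rk S (Suc i) (Suc j)"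
    using assms(4,5) increment_persists[of S i "Suc k" "Suc j"]
      increment_persists_to_right[of S "Suc l" j "Suc i"] by (auto simp del: rk.simps)
  moreover have "\<not> S (Suc i) (Suc j)"
    using S p assms(4,5) unfolding partial_perm_def by (metis \<open>x2 = Suc i\<close> \<open>y1 = Suc j\<close> less_irrefl)
  ultimately show False by (auto simp: max_def split: if_splits)
qed

section \<open>Chains and iterated shadows\<close>

definition chain ::
  "(nat \<Rightarrow> nat \<Rightarrow> bool) \<Rightarrow> (nat \<Rightarrow> nat \<Rightarrow> bool) \<Rightarrow> nat \<Rightarrow> nat \<Rightarrow> nat \<Rightarrow> (nat \<Rightarrow> nat) \<Rightarrow> (nat \<Rightarrow> nat) \<Rightarrow> bool"
where
  "chain R S I J k x y \<longleftrightarrow>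
     (\<forall>i<k. S (x i) (y i) \<and> x i \<le> I \<and> y i \<le> J) \<and>
     (\<forall>i. Suc i < k \<longrightarrow> x i < x (Suc i) \<and> R (y i) (y (Suc i)))"

lemma chain_0 [simp]: "chain R S I J 0 x y"
  by (simp add: chain_def)

text \<open>One point is taken to the left of the first shadow point, one between any two successive
  ones, and one below the last: \<open>k\<close> shadow points yield \<open>Suc k\<close>
  points.\<close>

lemma dec_chain_of_shadow:
  assumes S: "partial_perm S" and "0 < k" and c: "chain (>) (shadow S) I J k x y"
  shows "\<exists>x y. chain (>) S I J (Suc k) x y"
proof -
  have "\<exists>s t. S s t \<and> s \<le> I \<and> t \<le> J \<and> (0 < i \<longrightarrow> x (i - 1) \<le> s \<and> t < y (i - 1)) \<and>
      (i < k \<longrightarrow> s < x i \<and> y i \<le> t)" if i: "i \<le> k" for i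
  proof -
    consider "i = 0" | "i = k" "0 < i" | "0 < i" "i < k" using i by linarith
    then show ?thesis
    proof cases
      case 1
      with c \<open>0 < k\<close> have "shadow S (x 0) (y 0)" "x 0 \<le> I" "y 0 \<le> J" by (auto simp: chain_def)
      then show ?thesis using shadow_point_left[OF S] 1
        by (metis less_imp_le_nat less_irrefl order_refl order_trans)
    next
      case 2
      with c have "shadow S (x (i-1)) (y (i-1))" "x (i-1) \<le> I" "y (i-1) \<le> J"
        by (auto simp: chain_def)
      then show ?thesis using shadow_point_below[OF S] 2
        by (metis less_imp_le_nat less_irrefl order_refl order_trans)
    next
      case 3
      then have "Suc (i - 1) < k" "Suc (i - 1) = i" by auto
      with c 3 have "shadow S (x (i-1)) (y (i-1))" "shadow S (x i) (y i)"
        "x (i-1) < x i" "y i < y (i-1)" "x i \<le> I" "y (i-1) \<le> J"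
        unfolding chain_def by (metis less_imp_diff_less)+
      then show ?thesis using point_between_shadow_points[OF S, of "x (i-1)" "y (i-1)" "x i" "y i"] 3
        by (meson less_imp_le_nat order_trans)
    qed
  qed
  then obtain s t where st: "\<And>i. i \<le> k \<Longrightarrow> S (s i) (t i) \<and> s i \<le> I \<and> t i \<le> J \<and>
      (0 < i \<longrightarrow> x (i - 1) \<le> s i \<and> t i < y (i - 1)) \<and> (i < k \<longrightarrow> s i < x i \<and> y i \<le> t i)"
    by metis
  have "s i < s (Suc i) \<and> t (Suc i) < t i" if "i < k" for i
    using st[of i] st[of "Suc i"] that by auto
  then have "chain (>) S I J (Suc k) s t"
    using st by (simp add: chain_def)
  then show ?thesis by blast
qed

lemma dec_chain_to_shadow:
  assumes S: "partial_perm S" and c: "chain (>) S I J (Suc k) x y"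
  shows "\<exists>x y. chain (>) (shadow S) I J k x y"
proof -
  have "\<exists>s t. shadow S s t \<and> x i < s \<and> s \<le> x (Suc i) \<and> y (Suc i) < t \<and> t \<le> y i" if "i < k" for i
    using c that by (intro shadow_point_between_points[OF S]) (auto simp: chain_def)
  then obtain s t where st: "\<And>i. i < k \<Longrightarrow>
      shadow S (s i) (t i) \<and> x i < s i \<and> s i \<le> x (Suc i) \<and> y (Suc i) < t i \<and> t i \<le> y i"
    by metis
  have "s i \<le> I \<and> t i \<le> J" if "i < k" for i
    using st[OF that] c that unfolding chain_def
    by (meson Suc_less_eq less_SucI order_trans)
  moreover have "s i < s (Suc i) \<and> t (Suc i) < t i" if "Suc i < k" for i
    using st[of i] st[of "Suc i"] that by simp
  ultimately have "chain (>) (shadow S) I J k s t"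
    using st by (simp add: chain_def)
  then show ?thesis by blast
qed

lemma partial_perm_shadow_iter: "partial_perm S \<Longrightarrow> partial_perm ((shadow ^^ k) S)"
  by (induction k) (auto intro: partial_perm_shadow)

text \<open>Each shadow shortens decreasing chains by exactly one point, so after \<open>k\<close>
  shadows a chain of \<open>Suc k\<close> points has become a single point.\<close>

lemma dec_chain_iff_shadow_iter:
  assumes "partial_perm S"
  shows "(\<exists>x y. chain (>) S I J (Suc k) x y) \<longleftrightarrow> (\<exists>x\<le>I. \<exists>y\<le>J. (shadow ^^ k) S x y)"
proof -
  have "(\<exists>x y. chain (>) S I J (Suc k) x y) \<longleftrightarrow>
     (\<exists>x y. chain (>) ((shadow ^^ m) S) I J (Suc (k - m)) x y)" if "m \<le> k" for m
    using that
  proof (induction m)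
    case (Suc m)
    then have eq: "Suc (k - m) = Suc (Suc (k - Suc m))" by simp
    show ?case
      using Suc dec_chain_of_shadow[OF partial_perm_shadow_iter[OF assms, of m], of "Suc (k - Suc m)"]
        dec_chain_to_shadow[OF partial_perm_shadow_iter[OF assms, of m], of _ _ "Suc (k - Suc m)"]
      unfolding eq by (simp, blast)
  qed simp
  from this[of k] show ?thesis by (auto simp: chain_def)
qed

lemma rk_eq_0_iff:
  assumes "partial_perm S"
  shows "rk S i j = 0 \<longleftrightarrow> (\<forall>x\<le>i. \<forall>y\<le>j. \<not> S x y)"
proof -
  have pos: "\<not> S 0 y" "\<not> S x 0" for x y
    using assms unfolding partial_perm_def by blast+
  show ?thesis
  proof (induction i arbitrary: j)
    case 0
    then show ?case by (simp add: pos)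
  next
    case (Suc i)
    note IH = this
    show ?case
    proof (induction j)
      case 0
      then show ?case by (simp add: pos)
    next
      case (Suc j)
      have "rk S (Suc i) (Suc j) = 0 \<longleftrightarrow>
          rk S i (Suc j) = 0 \<and> rk S (Suc i) j = 0 \<and> \<not> S (Suc i) (Suc j)"
        by auto
      then show ?case unfolding Suc.IH IH by (auto simp: le_Suc_eq)
    qed
  qed
qed

text \<open>The two directions use different inductions: chains are built along the recursion of
  \<open>rk\<close>, and the bound comes from removing the last point of a chain.\<close>

lemma rk_eq_longest_inc_chain:
  assumes S: "partial_perm S"
  shows "m \<le> rk S i j \<longleftrightarrow> (\<exists>x y. chain (<) S i j m x y)"
proof
  have "\<exists>x y. chain (<) S i j (rk S i j) x y"
    using S
  proof (induction S i j rule: rk.induct)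
    case (3 S i j)
    show ?case
    proof (cases "S (Suc i) (Suc j)")
      case True
      define m where "m = rk S i j"
      have e: "rk S (Suc i) (Suc j) = Suc m" unfolding m_def by (rule rk_at_point[OF 3(3) True])
      \<comment> \<open>The recursion offers no hypothesis at \<open>(i, j)\<close>. The chain is
        taken from \<open>(i, Suc j)\<close>, where the rank is the same; it avoids row
        \<open>Suc j\<close>, whose only point is the new corner.\<close>
      have "m \<le> rk S i (Suc j)" unfolding m_def by (rule rk_le_Suc_right)
      moreover have "rk S i (Suc j) \<le> m" using e True by simp
      ultimately have "rk S i (Suc j) = m" by simp
      with 3(1,3) obtain x y where c: "chain (<) S i (Suc j) m x y" by auto
      have "y k \<le> j" if "k < m" for k
      proof -
        have "S (x k) (y k)" "y k \<le> Suc j" "x k \<le> i" using c that by (auto simp: chain_def)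
        moreover have "y k \<noteq> Suc j"
          using 3(3) True \<open>S (x k) (y k)\<close> \<open>x k \<le> i\<close> unfolding partial_perm_def
          by (metis Suc_n_not_le_n)
        ultimately show ?thesis by simp
      qed
      then have "chain (<) S (Suc i) (Suc j) (Suc m) (x(m := Suc i)) (y(m := Suc j))"
        using c True by (auto simp: chain_def less_Suc_eq_le le_Suc_eq)
      then show ?thesis unfolding e by blast
    next
      case False
      then have "rk S (Suc i) (Suc j) = rk S i (Suc j) \<or> rk S (Suc i) (Suc j) = rk S (Suc i) j"
        by auto
      moreover have "chain (<) S (Suc i) (Suc j) k x y"
        if "chain (<) S i (Suc j) k x y \<or> chain (<) S (Suc i) j k x y" for k x y
        using that by (auto simp: chain_def le_SucI)
      ultimately show ?thesis using 3 by metis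
    qed
  qed (use chain_0 in force)+
  moreover assume "m \<le> rk S i j"
  moreover have "chain (<) S i j k x y \<Longrightarrow> m \<le> k \<Longrightarrow> chain (<) S i j m x y" for k x y
    by (auto simp: chain_def)
  ultimately show "\<exists>x y. chain (<) S i j m x y" by blast
next
  assume "\<exists>x y. chain (<) S i j m x y"
  then obtain x y where "chain (<) S i j m x y" by blast
  then show "m \<le> rk S i j"
  proof (induction m arbitrary: i j)
    case (Suc m)
    then have p: "S (x m) (y m)" "x m \<le> i" "y m \<le> j" by (auto simp: chain_def)
    then obtain i' j' where e: "x m = Suc i'" "y m = Suc j'"
      using S unfolding partial_perm_def by (metis Suc_pred)
    have "x k \<le> i' \<and> y k \<le> j'" if "k < m" for k
    proof -
      have "x k < x m \<and> y k < y m"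
        using that Suc.prems
      proof (induction rule: strict_inc_induct)
        case (base l)
        then show ?case by (auto simp: chain_def)
      next
        case (step l)
        then have "x l < x (Suc l) \<and> y l < y (Suc l)" unfolding chain_def by auto
        then show ?case using step by auto
      qed
      then show ?thesis using e by auto
    qed
    then have "chain (<) S i' j' m x y" using Suc.prems by (auto simp: chain_def)
    then have "m \<le> rk S i' j'" by (rule Suc.IH)
    then have "Suc m \<le> rk S (x m) (y m)" using rk_at_point[OF S, of i' j'] p e by simp
    then show ?case using rk_mono[OF p(2,3), of S] by linarith
  qed simp
qed

section \<open>Avoidance in terms of growth diagrams\<close>

lemma chain_sorted:
  assumes "chain R S I J k x y" "transp R"
  shows "sorted_wrt (<) (map x [0..<k])" "sorted_wrt R (map y [0..<k])"
  using assms by (auto simp: sorted_wrt_iff_nth_Suc_transp chain_def)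

text \<open>A permutation of \<open>{1..n}\<close> fixes every other number. The point at the origin
  is removed, while the diagonal points beyond \<open>n\<close> stay and lie outside the diagram
  under study.\<close>

definition graph :: "(nat \<Rightarrow> nat) \<Rightarrow> nat \<Rightarrow> nat \<Rightarrow> bool" where
  "graph p x y \<longleftrightarrow> 0 < x \<and> p x = y"

lemma permutes_pos: "p permutes {1..n} \<Longrightarrow> 0 < p x \<longleftrightarrow> 0 < (x :: nat)"
  using permutes_in_image[of p "{1..n}" x] permutes_not_in[of p "{1..n}" x]
  by (cases "x \<in> {1..n}") auto

text \<open>The last entry of an occurrence is split off as a cross. The other \<open>L\<close>
  entries form a chain in the rectangle ending at the lower left corner of the square of that
  cross.\<close>

lemma avoids_incr_iff_chain:
  assumes p: "p permutes {1..n}"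
  shows "avoids_incr n L p \<longleftrightarrow>
    (\<forall>x\<in>{1..n}. \<not> (\<exists>s t. chain (<) (graph p) (x - 1) (p x - 1) L s t))"
proof -
  have "\<exists>is. length is = L + 1 \<and> set is \<subseteq> {1..n} \<and> sorted_wrt (<) is \<and> sorted_wrt (<) (map p is)"
    if x: "x \<in> {1..n}" and c: "chain (<) (graph p) (x - 1) (p x - 1) L s t" for x s t
  proof -
    have s: "s i < x \<and> 0 < s i \<and> p (s i) = t i \<and> t i < p x" if "i < L" for i
      using c that x permutes_pos[OF p, of x] unfolding chain_def graph_def by force
    have eq: "map (p \<circ> s) [0..<L] = map t [0..<L]" using s by auto
    have "sorted_wrt (<) (map p (map s [0..<L] @ [x]))"
      using chain_sorted(2)[OF c] s by (auto simp: sorted_wrt_append eq)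
    moreover have "sorted_wrt (<) (map s [0..<L] @ [x])"
      using chain_sorted(1)[OF c] s by (auto simp: sorted_wrt_append)
    moreover have "set (map s [0..<L] @ [x]) \<subseteq> {1..n}"
      using s x by force
    ultimately show ?thesis by (intro exI[of _ "map s [0..<L] @ [x]"]) simp
  qed
  moreover have "\<exists>x\<in>{1..n}. \<exists>s t. chain (<) (graph p) (x - 1) (p x - 1) L s t"
    if "length is = L + 1" "set is \<subseteq> {1..n}" and s: "sorted_wrt (<) is" "sorted_wrt (<) (map p is)" for "is"
  proof -
    have mem: "is ! i \<in> {1..n}" if "i \<le> L" for i
      using that \<open>length is = L + 1\<close> \<open>set is \<subseteq> {1..n}\<close> by (metis Suc_eq_plus1 le_imp_less_Suc nth_mem subsetD)
    have inc: "is ! i < is ! j \<and> p (is ! i) < p (is ! j)" if "i < j" "j \<le> L" for i j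
      using s that \<open>length is = L + 1\<close> by (auto simp: sorted_wrt_iff_nth_less)
    have "0 < is ! i \<and> is ! i \<le> is ! L - 1 \<and> p (is ! i) \<le> p (is ! L) - 1" if "i < L" for i
      using mem[of i] inc[of i L] that by auto
    moreover have "is ! i < is ! Suc i \<and> p (is ! i) < p (is ! Suc i)" if "Suc i < L" for i
      using inc[of i "Suc i"] that by simp
    ultimately have "chain (<) (graph p) (is ! L - 1) (p (is ! L) - 1) L (\<lambda>i. is ! i) (\<lambda>i. p (is ! i))"
      unfolding chain_def graph_def by blast
    then show ?thesis using mem[of L] by blast
  qed
  ultimately show ?thesis unfolding avoids_incr_def by blast
qed

lemma avoids_dec_then_up_iff_chain:
  assumes p: "p permutes {1..n}" and "0 < d"
  shows "avoids_dec_then_up n d p \<longleftrightarrow>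
    (\<forall>x\<in>{1..n}. \<not> (\<exists>s t. chain (>) (graph p) (x - 1) (p x - 1) d s t))"
proof -
  have "\<exists>is. length is = d + 1 \<and> set is \<subseteq> {1..n} \<and> sorted_wrt (<) is \<and>
      sorted_wrt (>) (map p (take d is)) \<and> p (is ! d) > p (is ! 0)"
    if x: "x \<in> {1..n}" and c: "chain (>) (graph p) (x - 1) (p x - 1) d s t" for x s t
  proof -
    have s: "s i < x \<and> 0 < s i \<and> p (s i) = t i \<and> t i < p x" if "i < d" for i
      using c that x permutes_pos[OF p, of x] unfolding chain_def graph_def by force
    have eq: "map (p \<circ> s) [0..<d] = map t [0..<d]" using s by auto
    have "sorted_wrt (>) (map p (take d (map s [0..<d] @ [x])))"
      using chain_sorted(2)[OF c] by (simp add: eq)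
    moreover have "sorted_wrt (<) (map s [0..<d] @ [x])"
      using chain_sorted(1)[OF c] s by (auto simp: sorted_wrt_append)
    moreover have "set (map s [0..<d] @ [x]) \<subseteq> {1..n}"
      using s x by force
    moreover have "p ((map s [0..<d] @ [x]) ! d) > p ((map s [0..<d] @ [x]) ! 0)"
      using s[of 0] \<open>0 < d\<close> by (auto simp: nth_append)
    ultimately show ?thesis by (intro exI[of _ "map s [0..<d] @ [x]"]) simp
  qed
  moreover have "\<exists>x\<in>{1..n}. \<exists>s t. chain (>) (graph p) (x - 1) (p x - 1) d s t"
    if "length is = d + 1" "set is \<subseteq> {1..n}" and s: "sorted_wrt (<) is"
      "sorted_wrt (>) (map p (take d is))" and up: "p (is ! d) > p (is ! 0)" for "is"
  proof -
    have mem: "is ! i \<in> {1..n}" if "i \<le> d" for i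
      using that \<open>length is = d + 1\<close> \<open>set is \<subseteq> {1..n}\<close> by (metis Suc_eq_plus1 le_imp_less_Suc nth_mem subsetD)
    have inc: "is ! i < is ! j" if "i < j" "j \<le> d" for i j
      using s(1) that \<open>length is = d + 1\<close> by (auto simp: sorted_wrt_iff_nth_less)
    have dec: "p (is ! j) < p (is ! i)" if "i < j" "j < d" for i j
      using s(2) that \<open>length is = d + 1\<close> by (auto simp: sorted_wrt_iff_nth_less)
    \<comment> \<open>The pattern compares the last entry only with the first one, which is the
      largest of the decreasing entries.\<close>
    have "p (is ! i) < p (is ! d)" if "i < d" for i
      using dec[of 0 i] that up by (cases "i = 0") auto
    then have "0 < is ! i \<and> is ! i \<le> is ! d - 1 \<and> p (is ! i) \<le> p (is ! d) - 1" if "i < d" for i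
      using mem[of i] inc[of i d] that by fastforce
    moreover have "is ! i < is ! Suc i \<and> p (is ! i) > p (is ! Suc i)" if "Suc i < d" for i
      using inc[of i "Suc i"] dec[of i "Suc i"] that by simp
    ultimately have "chain (>) (graph p) (is ! d - 1) (p (is ! d) - 1) d (\<lambda>i. is ! i) (\<lambda>i. p (is ! i))"
      unfolding chain_def graph_def by blast
    then show ?thesis using mem[of d] by blast
  qed
  ultimately show ?thesis unfolding avoids_dec_then_up_def by blast
qed

section \<open>Growth diagrams and the meaning of their first and last rows\<close>

text \<open>
  The labels of a square are called \<open>a\<close> (lower left), \<open>b\<close> (lower right),
  \<open>c\<close> (upper left) and \<open>e\<close> (upper right); \<open>X\<close> says that it contains a cross.
  Rows are numbered from 0.
\<close>

definition bump :: "nat list \<Rightarrow> nat list \<Rightarrow> nat list \<Rightarrow> nat \<Rightarrow> bool" where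
  "bump a b c k \<longleftrightarrow> a ! k < b ! k \<and> a ! k < c ! k"

text \<open>Fomin's local rule for Robinson-Schensted, closed up cyclically: a box bumped out of the
  last row enters the first. It is total; which inputs form a legitimate square is recorded by
  \<open>sq\<close> below.\<close>

definition fwd :: "nat \<Rightarrow> nat list \<Rightarrow> nat list \<Rightarrow> nat list \<Rightarrow> bool \<Rightarrow> nat list" where
  "fwd d a b c X = map (\<lambda>k. max (b ! k) (c ! k) +
     of_bool (if k = 0 then X \<or> bump a b c (d - 1) else bump a b c (k - 1))) [0..<d]"

fun grow :: "nat \<Rightarrow> (nat \<Rightarrow> nat) \<Rightarrow> nat \<Rightarrow> nat \<Rightarrow> nat list" where
  "grow d p 0 j = replicate d 0"
| "grow d p (Suc i) 0 = replicate d 0"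
| "grow d p (Suc i) (Suc j) =
     fwd d (grow d p i j) (grow d p (Suc i) j) (grow d p i (Suc j)) (p (Suc i) = Suc j)"

lemma fwd_nth: "k < d \<Longrightarrow> fwd d a b c X ! k = max (b ! k) (c ! k) +
     of_bool (if k = 0 then X \<or> bump a b c (d - 1) else bump a b c (k - 1))"
  by (simp add: fwd_def)

lemma fwd_commute: "fwd d a b c X = fwd d a c b X"
proof -
  have "bump a b c = bump a c b" by (auto simp: bump_def fun_eq_iff)
  then show ?thesis by (simp add: fwd_def max.commute)
qed

lemma grow_0_right [simp]: "grow d p i 0 = replicate d 0"
  by (cases i) auto

lemma partial_perm_graph:
  assumes "p permutes {1..n}"
  shows "partial_perm (graph p)"
  using permutes_pos[OF assms] permutes_inj[OF assms]
  unfolding partial_perm_def graph_def by (auto simp: inj_eq)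

lemma grow_mono:
  assumes "i \<le> i'" "j \<le> j'" "k < d"
  shows "grow d p i j ! k \<le> grow d p i' j' ! k"
proof -
  have 1: "grow d p i j ! k \<le> grow d p (Suc i) j ! k" for i j
    using assms(3) by (cases j) (auto simp: fwd_nth)
  have 2: "grow d p i j ! k \<le> grow d p i (Suc j) ! k" for i j
    using assms(3) by (cases i) (auto simp: fwd_nth)
  show ?thesis
    using lift_Suc_mono_le[of "\<lambda>i. grow d p i j ! k", OF 1 assms(1)]
      lift_Suc_mono_le[of "\<lambda>j. grow d p i' j ! k", OF 2 assms(2)] by linarith
qed

text \<open>
  The disjunction lets the same induction serve both directions of the next lemma.
\<close>

lemma grow_eq_rk:
  assumes z: "\<And>i j. i \<le> I \<Longrightarrow> j \<le> J \<Longrightarrow>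
      grow d p i j ! (d - 1) = 0 \<or> rk ((shadow ^^ (d - 1)) (graph p)) i j = 0"
  shows "i \<le> I \<Longrightarrow> j \<le> J \<Longrightarrow> k < d \<Longrightarrow> grow d p i j ! k = rk ((shadow ^^ k) (graph p)) i j"
proof (induction "i + j" arbitrary: i j k rule: less_induct)
  case less
  let ?r = "\<lambda>k. rk ((shadow ^^ k) (graph p))"
  show ?case
  proof (cases "i = 0 \<or> j = 0")
    case True
    then show ?thesis using less.prems by auto
  next
    case False
    then obtain i' j' where e: "i = Suc i'" "j = Suc j'" by (metis not0_implies_Suc)
    note le = less.prems[unfolded e]
    have IH: "grow d p i' j' ! m = ?r m i' j'" "grow d p (Suc i') j' ! m = ?r m (Suc i') j'"
      "grow d p i' (Suc j') ! m = ?r m i' (Suc j')" if "m < d" for m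
      using that le e by (auto intro!: less.hyps)
    \<comment> \<open>By either alternative in \<open>z\<close> the last row is still empty at the
      lower right corner, so no box wraps around.\<close>
    have no: "\<not> bump (grow d p i' j') (grow d p (Suc i') j') (grow d p i' (Suc j')) (d - 1)"
      using z[of "Suc i'" j'] IH(2)[of "d - 1"] le by (auto simp: bump_def)
    show ?thesis
    proof (cases k)
      case 0
      then show ?thesis using no le IH[of 0] by (simp add: e fwd_nth graph_def max.commute)
    next
      case (Suc m)
      \<comment> \<open>By induction row \<open>m\<close> is the rank function of the
        \<open>m\<close>-th shadow, so it bumps exactly at the points of the next shadow.\<close>
      have "bump (grow d p i' j') (grow d p (Suc i') j') (grow d p i' (Suc j')) m \<longleftrightarrow>
          (shadow ^^ k) (graph p) (Suc i') (Suc j')"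
        using le IH[of m] by (simp add: Suc bump_def shadow_def)
      then show ?thesis using le IH[of k] Suc by (simp add: e fwd_nth max.commute)
    qed
  qed
qed

text \<open>Both quantities are monotone, so vanishing at \<open>(i, j)\<close> of either one
  spreads to the whole rectangle and supplies one alternative of \<open>grow_eq_rk\<close>.\<close>

lemma grow_last_eq_0_iff:
  assumes "0 < d"
  shows "grow d p i j ! (d - 1) = 0 \<longleftrightarrow> rk ((shadow ^^ (d - 1)) (graph p)) i j = 0"
proof
  assume "grow d p i j ! (d - 1) = 0"
  then have "grow d p i' j' ! (d - 1) = 0" if "i' \<le> i" "j' \<le> j" for i' j'
    using grow_mono[OF that, of "d - 1" d p] assms by simp
  then show "rk ((shadow ^^ (d - 1)) (graph p)) i j = 0"
    using grow_eq_rk[of i j d p i j "d - 1"] assms by simp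
next
  assume "rk ((shadow ^^ (d - 1)) (graph p)) i j = 0"
  then have "rk ((shadow ^^ (d - 1)) (graph p)) i' j' = 0" if "i' \<le> i" "j' \<le> j" for i' j'
    using rk_mono[OF that, of "(shadow ^^ (d - 1)) (graph p)"] by simp
  then show "grow d p i j ! (d - 1) = 0"
    using grow_eq_rk[of i j d p i j "d - 1"] assms by simp
qed

lemma grow_hd_eq_rk:
  assumes "0 < d" "grow d p i j ! (d - 1) = 0"
  shows "grow d p i j ! 0 = rk (graph p) i j"
proof -
  have "grow d p i' j' ! (d - 1) = 0" if "i' \<le> i" "j' \<le> j" for i' j'
    using grow_mono[OF that, of "d - 1" d p] assms by simp
  then show ?thesis
    using grow_eq_rk[of i j d p i j 0] assms by simp
qed

definition admissible :: "nat \<Rightarrow> nat \<Rightarrow> nat list \<Rightarrow> bool" where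
  "admissible d L a \<longleftrightarrow> a ! (d - 1) = 0 \<and> a ! 0 < L"

text \<open>The label is the one at the lower left corner of the square of a cross. Its last part
  detects decreasing chains of length \<open>d\<close>; once that part is zero, the first part is
  the rank and detects increasing chains of length \<open>L\<close>.\<close>

lemma avoiders_iff_admissible:
  assumes "0 < d"
  shows "p \<in> avoiders n d L \<longleftrightarrow> p permutes {1..n} \<and>
    (\<forall>x\<in>{1..n}. admissible d L (grow d p (x - 1) (p x - 1)))"
proof (cases "p permutes {1..n}")
  case True
  note S = partial_perm_graph[OF True]
  have "admissible d L (grow d p i j) \<longleftrightarrow>
      \<not> (\<exists>s t. chain (>) (graph p) i j d s t) \<and> \<not> (\<exists>s t. chain (<) (graph p) i j L s t)" for i j
  proof -
    have "(\<exists>s t. chain (>) (graph p) i j d s t) \<longleftrightarrow> grow d p i j ! (d - 1) \<noteq> 0"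
      using dec_chain_iff_shadow_iter[OF S, of i j "d - 1"] assms grow_last_eq_0_iff[OF assms, of p i j]
        rk_eq_0_iff[OF partial_perm_shadow_iter[OF S], of "d - 1" i j] by simp
    moreover have "(\<exists>s t. chain (<) (graph p) i j L s t) \<longleftrightarrow> L \<le> rk (graph p) i j"
      using rk_eq_longest_inc_chain[OF S] by blast
    ultimately show ?thesis
      using grow_hd_eq_rk[OF assms, of p i j] unfolding admissible_def by auto
  qed
  then show ?thesis
    using True avoids_incr_iff_chain[OF True, of L] avoids_dec_then_up_iff_chain[OF True assms]
    unfolding avoiders_def by blast
next
  case False
  then show ?thesis by (simp add: avoiders_def)
qed

section \<open>The cyclic local rule\<close>

text \<open>Extended by \<open>a (k + d) = a k - L\<close>, such a sequence is weakly decreasing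
  over all integers. The wrap-around inequality is written additively to avoid truncated
  subtraction.\<close>

definition cyl_part :: "nat \<Rightarrow> nat \<Rightarrow> nat list \<Rightarrow> bool" where
  "cyl_part d L a \<longleftrightarrow>
     length a = d \<and> (\<forall>k. Suc k < d \<longrightarrow> a ! Suc k \<le> a ! k) \<and> a ! 0 \<le> a ! (d - 1) + L"

definition inc :: "nat \<Rightarrow> nat list \<Rightarrow> nat list" where
  "inc k a = a[k := Suc (a ! k)]"

definition nxt :: "nat \<Rightarrow> nat \<Rightarrow> nat" where
  "nxt d k = (if Suc k = d then 0 else Suc k)"

text \<open>Equality is allowed because an edge carries no box until the cross of its row or column
  has been passed.\<close>

definition box_step :: "nat \<Rightarrow> nat \<Rightarrow> nat list \<Rightarrow> nat list \<Rightarrow> bool" where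
  "box_step d L a b \<longleftrightarrow> cyl_part d L a \<and> cyl_part d L b \<and> (a = b \<or> (\<exists>k<d. b = inc k a))"

text \<open>A relation, so that the forward and the backward rule can be read off one list of cases.
  Admissibility in \<open>cross\<close> separates this case from a bump out of the last row, which
  also adds a box in row 0 on both edges into \<open>e\<close>.\<close>

inductive sq :: "nat \<Rightarrow> nat \<Rightarrow> nat list \<Rightarrow> nat list \<Rightarrow> nat list \<Rightarrow> nat list \<Rightarrow> bool \<Rightarrow> bool"
  for d L where
  none: "cyl_part d L a \<Longrightarrow> sq d L a a a a False"
| horizontal: "cyl_part d L a \<Longrightarrow> k < d \<Longrightarrow> cyl_part d L (inc k a) \<Longrightarrow>
    sq d L a (inc k a) a (inc k a) False"
| vertical: "cyl_part d L a \<Longrightarrow> k < d \<Longrightarrow> cyl_part d L (inc k a) \<Longrightarrow>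
    sq d L a a (inc k a) (inc k a) False"
| distinct: "cyl_part d L a \<Longrightarrow> i < d \<Longrightarrow> j < d \<Longrightarrow> i \<noteq> j \<Longrightarrow>
    cyl_part d L (inc i a) \<Longrightarrow> cyl_part d L (inc j a) \<Longrightarrow> cyl_part d L (inc j (inc i a)) \<Longrightarrow>
    sq d L a (inc i a) (inc j a) (inc j (inc i a)) False"
| bump: "cyl_part d L a \<Longrightarrow> i < d \<Longrightarrow> cyl_part d L (inc i a) \<Longrightarrow>
    cyl_part d L (inc (nxt d i) (inc i a)) \<Longrightarrow>
    sq d L a (inc i a) (inc i a) (inc (nxt d i) (inc i a)) False"
| cross: "cyl_part d L a \<Longrightarrow> cyl_part d L (inc 0 a) \<Longrightarrow> admissible d L a \<Longrightarrow>
    sq d L a a a (inc 0 a) True"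

text \<open>
  Truncated subtraction matters here: at a cross the condition holds in the last row, whose entry
  is zero and stays so.
\<close>

definition bwd :: "nat \<Rightarrow> nat list \<Rightarrow> nat list \<Rightarrow> nat list \<Rightarrow> nat list" where
  "bwd d b c e = map (\<lambda>k. min (b ! k) (c ! k) -
     of_bool (b ! nxt d k < e ! nxt d k \<and> c ! nxt d k < e ! nxt d k)) [0..<d]"

lemma length_inc [simp]: "length (inc k a) = length a"
  by (simp add: inc_def)

lemma inc_nth: "k < length a \<Longrightarrow> inc k a ! m = (if m = k then Suc (a ! k) else a ! m)"
  by (auto simp: inc_def nth_list_update)

lemma inc_commute: "inc j (inc i a) = inc i (inc j a)"
  by (cases "i = j") (auto simp: inc_def list_update_swap)

lemma cyl_part_length: "cyl_part d L a \<Longrightarrow> length a = d"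
  by (simp add: cyl_part_def)

lemma nxt_less: "k < d \<Longrightarrow> nxt d k < d"
  by (auto simp: nxt_def)

lemma nxt_eq_iff: "i < d \<Longrightarrow> k < d \<Longrightarrow> nxt d i = nxt d k \<longleftrightarrow> i = k"
  by (auto simp: nxt_def)

lemma inc_neq: "k < length a \<Longrightarrow> inc k a \<noteq> a"
  by (metis inc_nth n_not_Suc_n)

text \<open>This form treats the wrap-around inequality like the others, so that adding or removing
  boxes can be checked in all rows at once.\<close>

lemma cyl_part_iff_cyclic:
  assumes "0 < d"
  shows "cyl_part d L a \<longleftrightarrow>
     length a = d \<and> (\<forall>k<d. a ! nxt d k \<le> a ! k + (if Suc k = d then L else 0))"
proof
  assume a: "cyl_part d L a"
  have "a ! nxt d k \<le> a ! k + (if Suc k = d then L else 0)" if "k < d" for k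
  proof (cases "Suc k = d")
    case True
    then have "d - 1 = k" by simp
    then show ?thesis using a True by (simp add: cyl_part_def nxt_def)
  next
    case False
    then show ?thesis using a that by (simp add: cyl_part_def nxt_def)
  qed
  then show "length a = d \<and> (\<forall>k<d. a ! nxt d k \<le> a ! k + (if Suc k = d then L else 0))"
    using a by (simp add: cyl_part_def)
next
  assume r: "length a = d \<and> (\<forall>k<d. a ! nxt d k \<le> a ! k + (if Suc k = d then L else 0))"
  have "a ! Suc k \<le> a ! k" if "Suc k < d" for k
    using r[THEN conjunct2, rule_format, of k] that by (simp add: nxt_def)
  moreover have "a ! 0 \<le> a ! (d - 1) + L"
    using r[THEN conjunct2, rule_format, of "d - 1"] assms by (simp add: nxt_def)
  ultimately show "cyl_part d L a" using r by (simp add: cyl_part_def)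
qed

lemma cyl_partI:
  assumes "0 < d" "length a = d"
    and "\<And>k. k < d \<Longrightarrow> a ! nxt d k \<le> a ! k + (if Suc k = d then L else 0)"
  shows "cyl_part d L a"
  using assms by (simp add: cyl_part_iff_cyclic)

lemma cyl_partD: "cyl_part d L a \<Longrightarrow> k < d \<Longrightarrow> a ! nxt d k \<le> a ! k + (if Suc k = d then L else 0)"
  using cyl_part_iff_cyclic[of d L a] by simp

lemma sq_swap: "sq d L a b c e X \<Longrightarrow> sq d L a c b e X"
proof (induction rule: sq.induct)
  case (distinct a i j)
  then show ?case using sq.distinct[of d L a j i] inc_commute[of i j a] by simp
qed (auto intro: sq.intros)

lemma sq_box_step:
  assumes "sq d L a b c e X" "0 < d"
  shows "box_step d L a b" "box_step d L a c" "box_step d L b e" "box_step d L c e"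
proof -
  show "box_step d L a b" "box_step d L a c" "box_step d L b e"
    using assms by (induction rule: sq.induct) (auto simp: box_step_def intro: nxt_less)
  show "box_step d L c e"
    using assms
  proof (induction rule: sq.induct)
    case (distinct a i j)
    then show ?case using inc_commute[of i j a] by (auto simp: box_step_def)
  qed (auto simp: box_step_def intro: nxt_less)
qed

lemma sq_cross:
  assumes "sq d L a b c e True"
  shows "a = b" "a = c" "admissible d L a"
  using assms by (auto elim: sq.cases)

text \<open>Used to count crosses: applied along a column, it shows that an edge carries a box iff a
  cross lies below it.\<close>

lemma sq_edge:
  assumes "sq d L a b c e X" "0 < d"
  shows "c \<noteq> e \<longleftrightarrow> a \<noteq> b \<or> X"
  using assms
proof (induction rule: sq.induct)
  case (distinct a i j)
  then show ?case using inc_neq cyl_part_length inc_commute by (metis (no_types))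
next
  case (bump a i)
  then show ?case using inc_neq cyl_part_length nxt_less by (metis (no_types))
next
  case (cross a)
  then show ?case using inc_neq cyl_part_length by (metis (no_types))
qed (use inc_neq cyl_part_length in metis)+

lemma sq_fwd:
  assumes "sq d L a b c e X" "0 < d"
  shows "e = fwd d a b c X"
proof (rule nth_equalityI)
  show "length e = length (fwd d a b c X)"
    using sq_box_step(4)[OF assms] by (simp add: box_step_def cyl_part_def fwd_def)
next
  fix k assume "k < length e"
  then have "k < d" using sq_box_step(4)[OF assms] by (simp add: box_step_def cyl_part_def)
  with assms show "e ! k = fwd d a b c X ! k"
    by (induction rule: sq.induct)
      (auto simp: fwd_nth bump_def inc_nth cyl_part_length nxt_def split: if_splits)
qed

text \<open>After a bump from row \<open>i\<close>, the cyclically next row grows on both edges into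
  \<open>e\<close>. As \<open>nxt\<close> is injective, this reveals the row that loses a
  box.\<close>

lemma sq_bwd:
  assumes "sq d L a b c e X" "0 < d"
  shows "a = bwd d b c e"
proof (rule nth_equalityI)
  show "length a = length (bwd d b c e)"
    using sq_box_step(1)[OF assms] by (simp add: box_step_def cyl_part_def bwd_def)
next
  fix k assume "k < length a"
  then have "k < d" using sq_box_step(1)[OF assms] by (simp add: box_step_def cyl_part_def)
  with assms show "a ! k = bwd d b c e ! k"
  proof (induction rule: sq.induct)
    case (cross a)
    then show ?case
      by (auto simp: bwd_def inc_nth cyl_part_length admissible_def nxt_def split: if_splits)
  qed (auto simp: bwd_def inc_nth cyl_part_length nxt_less nxt_eq_iff split: if_splits)
qed

text \<open>Row 0 grows on both edges after a cross or after a bump out of the last row. The bump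
  leaves a positive last part in \<open>b\<close>, whereas at a cross it is zero.\<close>

lemma sq_bwd_cross:
  assumes "sq d L a b c e X" "0 < d"
  shows "X \<longleftrightarrow> b ! 0 < e ! 0 \<and> c ! 0 < e ! 0 \<and> b ! (d - 1) = 0"
  using assms
  by (induction rule: sq.induct)
    (auto simp: inc_nth cyl_part_length nxt_less nxt_def admissible_def split: if_splits)

text \<open>The issue is that the fourth corner is again cylindric. At a cross this is
  admissibility; in a bump, the next row may grow because row \<open>i\<close> has just
  grown.\<close>

lemma sq_fwd_exists:
  assumes "0 < d" and ab: "box_step d L a b" and ac: "box_step d L a c"
    and X: "X \<Longrightarrow> a = b \<and> a = c \<and> admissible d L a"
  shows "\<exists>e. sq d L a b c e X"
proof (cases X)
  case True
  then have "a = b" "a = c" "admissible d L a" using X by auto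
  moreover have "cyl_part d L a" using ab by (simp add: box_step_def)
  moreover have "cyl_part d L (inc 0 a)"
    using \<open>cyl_part d L a\<close> \<open>admissible d L a\<close> \<open>0 < d\<close>
    by (auto simp: cyl_part_def admissible_def inc_nth le_Suc_eq)
  ultimately show ?thesis using True by (auto intro: sq.intros)
next
  case False
  have a: "cyl_part d L a" "cyl_part d L b" "cyl_part d L c" using ab ac by (auto simp: box_step_def)
  consider "b = a" | "c = a" | i j where "i < d" "j < d" "b = inc i a" "c = inc j a"
    using ab ac unfolding box_step_def by blast
  then show ?thesis
  proof cases
    case 1
    then show ?thesis using ac False by (auto simp: box_step_def intro: sq.intros)
  next
    case 2
    then show ?thesis using ab False by (auto simp: box_step_def intro: sq.intros)
  next
    case 3
    show ?thesis
    proof (cases "i = j")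
      case True
      have "cyl_part d L (inc (nxt d i) (inc i a))"
      proof (rule cyl_partI)
        fix k assume "k < d"
        then show "inc (nxt d i) (inc i a) ! nxt d k \<le>
            inc (nxt d i) (inc i a) ! k + (if Suc k = d then L else 0)"
          using cyl_partD[OF a(1) \<open>k < d\<close>] cyl_partD[OF a(2) \<open>k < d\<close>] 3 nxt_less[of i d]
            nxt_eq_iff[of i d k] cyl_part_length[OF a(1)]
          by (auto simp: inc_nth split: if_splits)
      qed (use \<open>0 < d\<close> cyl_part_length[OF a(1)] in simp_all)
      then show ?thesis using 3 True a False by (auto intro: sq.intros)
    next
      case neq: False
      have "cyl_part d L (inc j (inc i a))"
      proof (rule cyl_partI)
        fix k assume "k < d"
        then show "inc j (inc i a) ! nxt d k \<le> inc j (inc i a) ! k + (if Suc k = d then L else 0)"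
          using cyl_partD[OF a(1) \<open>k < d\<close>] cyl_partD[OF a(2) \<open>k < d\<close>] cyl_partD[OF a(3) \<open>k < d\<close>]
            3 neq cyl_part_length[OF a(1)] by (simp add: inc_nth split: if_splits)
      qed (use \<open>0 < d\<close> cyl_part_length[OF a(1)] in simp_all)
      then show ?thesis using 3 neq a False by (auto intro: sq.intros)
    qed
  qed
qed

lemma inc_dec:
  assumes "k < length b" "0 < b ! k"
  shows "inc k (b[k := b ! k - 1]) = b"
  using assms by (intro nth_equalityI) (auto simp: inc_nth)

text \<open>The critical case is a box added to the same row \<open>i\<close> on both edges into
  \<open>e\<close>. The square is a bump from the cyclically preceding row \<open>k\<close> if that
  row of \<open>b\<close> is nonempty, and a cross otherwise.\<close>

lemma sq_bwd_exists:
  assumes "0 < d" "0 < L" and be: "box_step d L b e" and ce: "box_step d L c e"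
  shows "\<exists>a X. sq d L a b c e X"
proof -
  have cyl: "cyl_part d L e" "cyl_part d L b" "cyl_part d L c" using be ce by (auto simp: box_step_def)
  then have len: "length e = d" "length b = d" "length c = d" by (auto simp: cyl_part_length)
  consider "b = e" | "c = e" | i j where "i < d" "j < d" "e = inc i b" "e = inc j c"
    using be ce unfolding box_step_def by blast
  then show ?thesis
  proof cases
    case 1
    then show ?thesis using ce by (auto simp: box_step_def intro: sq.intros)
  next
    case 2
    then show ?thesis using be by (auto simp: box_step_def intro: sq.intros)
  next
    case 3
    have e: "e ! m = (if m = i then Suc (b ! i) else b ! m)"
        "e ! m = (if m = j then Suc (c ! j) else c ! m)" for m
      using 3 len inc_nth by metis+
    show ?thesis
    proof (cases "i = j")
      case True
      have "b ! m = c ! m" for m using e[of m] True by (auto split: if_splits)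
      then have [simp]: "c = b" using len by (auto intro: nth_equalityI)
      define k where "k = (if i = 0 then d - 1 else i - 1)"
      have k: "k < d" "nxt d k = i" using 3 by (auto simp: k_def nxt_def)
      show ?thesis
      proof (cases "b ! k = 0")
        case False
        define a where "a = b[k := b ! k - 1]"
        have b: "b = inc k a" using inc_dec[of k b] False k len by (simp add: a_def)
        have "length a = d" using len by (simp add: a_def)
        have "cyl_part d L a"
        proof (rule cyl_partI)
          fix m assume "m < d"
          then show "a ! nxt d m \<le> a ! m + (if Suc m = d then L else 0)"
            using cyl_partD[OF cyl(1) \<open>m < d\<close>] cyl_partD[OF cyl(2) \<open>m < d\<close>] 3(1) k
              nxt_eq_iff[of k d m] \<open>length a = d\<close> unfolding \<open>e = inc i b\<close> b
            by (simp add: inc_nth split: if_splits)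
        qed (use \<open>0 < d\<close> \<open>length a = d\<close> in simp_all)
        then show ?thesis using sq.bump[of d L a k] k cyl 3 b by auto
      next
        case True
        \<comment> \<open>Otherwise row \<open>i\<close> of \<open>e\<close> would be longer than
          the empty row directly above it.\<close>
        have "i = 0"
        proof (rule ccontr)
          assume "i \<noteq> 0"
          then have "Suc k = i" by (simp add: k_def)
          then have "e ! i \<le> e ! k" using cyl(1) 3(1) unfolding cyl_part_def by blast
          then show False using True e(1)[of i] e(1)[of k] \<open>Suc k = i\<close> by simp
        qed
        \<comment> \<open>For \<open>d > 1\<close> the bound on the first part is the cylindric
          inequality for \<open>e\<close>; for \<open>d = 1\<close> that part is zero and
          \<open>0 < L\<close> gives it.\<close>
        then have "admissible d L b"
          using True cyl(1) e(1)[of 0] e(1)[of "d - 1"] \<open>0 < L\<close>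
          by (auto simp: admissible_def k_def cyl_part_def split: if_splits)
        then show ?thesis using sq.cross[of d L b] cyl 3 \<open>i = 0\<close> by auto
      qed
    next
      case False
      \<comment> \<open>The corner \<open>e\<close> has one more box than \<open>c\<close> in row
        \<open>j\<close>; since \<open>i\<close> and \<open>j\<close> differ, this box is already in
        \<open>b\<close> and must be taken away.\<close>
      define a where "a = b[j := b ! j - 1]"
      have "b ! j = Suc (c ! j)" using e[of j] False by auto
      then have b: "b = inc j a" using inc_dec[of j b] 3 len by (simp add: a_def)
      have "length a = d" using len by (simp add: a_def)
      have "c ! m = inc i a ! m" for m
        using e[of m] e[of i] e[of j] False 3 len \<open>length a = d\<close>
        by (auto simp: inc_nth a_def nth_list_update split: if_splits)
      then have c: "c = inc i a" using len \<open>length a = d\<close> by (auto intro: nth_equalityI)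
      have "cyl_part d L a"
      proof (rule cyl_partI)
        fix k assume "k < d"
        then show "a ! nxt d k \<le> a ! k + (if Suc k = d then L else 0)"
          using cyl_partD[OF cyl(1) \<open>k < d\<close>] cyl_partD[OF cyl(2) \<open>k < d\<close>] cyl_partD[OF cyl(3) \<open>k < d\<close>]
            3(1,2) False \<open>length a = d\<close> unfolding \<open>e = inc i b\<close> b c
          by (simp add: inc_nth split: if_splits)
      qed (use \<open>0 < d\<close> \<open>length a = d\<close> in simp_all)
      then show ?thesis using sq.distinct[of d L a j i] cyl 3 False b c by auto
    qed
  qed
qed

section \<open>Cylindric tableaux and the bijection\<close>

lemma cyl_part_replicate: "0 < d \<Longrightarrow> cyl_part d L (replicate d 0)"
  by (simp add: cyl_part_def)

text \<open>This forces the bottom and left boundary to be zero in a diagram reconstructed from its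
  upper right corner.\<close>

lemma box_step_replicate: "box_step d L a (replicate d 0) \<Longrightarrow> a = replicate d 0"
  unfolding box_step_def by (metis cyl_part_length inc_nth nat.distinct(1) nth_replicate)

lemma sum_list_inc: "k < length a \<Longrightarrow> sum_list (inc k a) = Suc (sum_list a)"
  by (induction a arbitrary: k) (auto simp: inc_def split: nat.splits)

lemma pointwise_le_sum_list_Suc:
  fixes a b :: "nat list"
  assumes "length a = length b" "\<And>k. k < length a \<Longrightarrow> a ! k \<le> b ! k"
    and "sum_list b = Suc (sum_list a)"
  shows "\<exists>k<length a. b = inc k a"
  using assms
proof (induction a b rule: list_induct2)
  case (Cons x xs y ys)
  have le: "x \<le> y" "\<And>k. k < length xs \<Longrightarrow> xs ! k \<le> ys ! k"
    using Cons.prems(1)[of 0] Cons.prems(1)[of "Suc _"] by auto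
  then have sle: "sum_list xs \<le> sum_list ys"
    using Cons.hyps by (intro sum_list_mono2) auto
  show ?case
  proof (cases "y = x")
    case True
    then obtain k where "k < length xs" "ys = inc k xs"
      using Cons.IH[OF le(2)] Cons.prems(2) by auto
    then show ?thesis using True by (intro exI[of _ "Suc k"]) (auto simp: inc_def)
  next
    case False
    then have "y = Suc x" "sum_list ys = sum_list xs" using sle le Cons.prems(2) by auto
    moreover have "ys = xs"
    proof (rule ccontr)
      assume "ys \<noteq> xs"
      then obtain k where k: "k < length xs" "xs ! k < ys ! k"
        using Cons.hyps le(2) by (metis nth_equalityI order_le_neq_trans)
      have "(\<Sum>i<length xs. xs ! i) < (\<Sum>i<length xs. ys ! i)"
        using k le(2) by (intro sum_strict_mono_ex1) auto
      then show False using \<open>sum_list ys = sum_list xs\<close> Cons.hyps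
        by (simp add: sum_list_sum_nth atLeast0LessThan)
    qed
    ultimately show ?thesis by (intro exI[of _ 0]) (auto simp: inc_def)
  qed
qed simp

lemma dpart_iff: "dpart d a \<longleftrightarrow> length a = d \<and> (\<forall>k. Suc k < d \<longrightarrow> a ! Suc k \<le> a ! k)"
  unfolding dpart_def
  by (metis (mono_tags, lifting) sorted_wrt_iff_nth_Suc_transp transp_on_ge)

text \<open>When a single box is added, interlacing amounts to both partitions being cylindric. The
  wrap-around condition compares \<open>b ! 0\<close> with \<open>a ! (d - 1)\<close>: for
  \<open>d > 1\<close> the box changes at most one of the first and last parts, and for
  \<open>d = 1\<close> it is covered by \<open>0 < L\<close>.\<close>

lemma cylSYT_step_iff:
  assumes "0 < d" "0 < L" and a: "cyl_part d L a"
  shows "dpart d b \<and> cyl_prec d L a b \<and> size_part b = size_part a + 1 \<longleftrightarrow>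
    box_step d L a b \<and> a \<noteq> b"
proof
  assume l: "dpart d b \<and> cyl_prec d L a b \<and> size_part b = size_part a + 1"
  have "\<exists>k<d. b = inc k a"
    using pointwise_le_sum_list_Suc[of a b] l cyl_part_length[OF a]
    by (auto simp: cyl_prec_def size_part_def dpart_def)
  moreover have "cyl_part d L b"
  proof -
    have "int (b ! 0) - int L \<le> int (a ! (d - 1))" "a ! (d - 1) \<le> b ! (d - 1)"
      using l \<open>0 < d\<close> by (auto simp: cyl_prec_def)
    then show ?thesis using l by (auto simp: cyl_part_def dpart_iff)
  qed
  moreover have "a \<noteq> b" using l by auto
  ultimately show "box_step d L a b \<and> a \<noteq> b" using a by (auto simp: box_step_def)
next
  assume r: "box_step d L a b \<and> a \<noteq> b"
  then obtain k where k: "k < d" "b = inc k a" and b: "cyl_part d L b" by (auto simp: box_step_def)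
  have nth: "b ! m = (if m = k then Suc (a ! m) else a ! m)" for m
    using k cyl_part_length[OF a] by (simp add: inc_nth)
  have "b ! (i + 1) \<le> a ! i" if "i + 1 < d" for i
  proof -
    have "b ! Suc i \<le> b ! i" "a ! Suc i \<le> a ! i" using a b that by (auto simp: cyl_part_def)
    then show ?thesis using nth[of i] nth[of "Suc i"] by (auto split: if_splits)
  qed
  moreover have "int (a ! (d - 1)) \<ge> int (b ! 0) - int L"
  proof -
    have "b ! 0 \<le> b ! (d - 1) + L" "a ! 0 \<le> a ! (d - 1) + L" using a b by (auto simp: cyl_part_def)
    then show ?thesis
      using nth[of 0] nth[of "d - 1"] \<open>0 < L\<close> by (auto split: if_splits)
  qed
  ultimately have "cyl_prec d L a b" using nth by (auto simp: cyl_prec_def)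
  then show "dpart d b \<and> cyl_prec d L a b \<and> size_part b = size_part a + 1"
    using b k cyl_part_length[OF a] by (auto simp: dpart_iff cyl_part_def size_part_def sum_list_inc)
qed

lemma cylSYT_iff:
  assumes "0 < d" "0 < L"
  shows "T \<in> cylSYT n d L \<longleftrightarrow> length T = Suc n \<and> T ! 0 = replicate d 0 \<and>
    (\<forall>i<n. box_step d L (T ! i) (T ! Suc i) \<and> T ! i \<noteq> T ! Suc i)"
proof
  assume T: "T \<in> cylSYT n d L"
  have "cyl_part d L (T ! i)" if "i \<le> n" for i
    using that
  proof (induction i)
    case 0
    then show ?case using T cyl_part_replicate[OF assms(1)] by (simp add: cylSYT_def)
  next
    case (Suc i)
    then have "box_step d L (T ! i) (T ! Suc i)"
      using T cylSYT_step_iff[OF assms, of "T ! i" "T ! Suc i"] by (simp add: cylSYT_def)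
    then show ?case by (simp add: box_step_def)
  qed
  then have "box_step d L (T ! i) (T ! Suc i) \<and> T ! i \<noteq> T ! Suc i" if "i < n" for i
    using that T cylSYT_step_iff[OF assms, of "T ! i" "T ! Suc i"] by (simp add: cylSYT_def)
  then show "length T = Suc n \<and> T ! 0 = replicate d 0 \<and>
    (\<forall>i<n. box_step d L (T ! i) (T ! Suc i) \<and> T ! i \<noteq> T ! Suc i)"
    using T by (simp add: cylSYT_def)
next
  assume T: "length T = Suc n \<and> T ! 0 = replicate d 0 \<and>
    (\<forall>i<n. box_step d L (T ! i) (T ! Suc i) \<and> T ! i \<noteq> T ! Suc i)"
  have st: "dpart d (T ! Suc i) \<and> cyl_prec d L (T ! i) (T ! Suc i) \<and>
      size_part (T ! Suc i) = size_part (T ! i) + 1" if "i < n" for i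
    using T that cylSYT_step_iff[OF assms, of "T ! i" "T ! Suc i"] by (auto simp: box_step_def)
  have "dpart d (T ! i)" if "i \<le> n" for i
  proof (cases i)
    case 0
    then show ?thesis using T by (simp add: dpart_iff)
  next
    case (Suc m)
    then show ?thesis using st[of m] that by simp
  qed
  then show "T \<in> cylSYT n d L" using T st by (simp add: cylSYT_def)
qed

section \<open>Diagrams made of squares and the position of their crosses\<close>

definition sq_at ::
  "nat \<Rightarrow> nat \<Rightarrow> (nat \<Rightarrow> nat \<Rightarrow> nat list) \<Rightarrow> (nat \<Rightarrow> nat \<Rightarrow> bool) \<Rightarrow> nat \<Rightarrow> nat \<Rightarrow> bool" where
  "sq_at d L G X i j \<longleftrightarrow>
     sq d L (G i j) (G (Suc i) j) (G i (Suc j)) (G (Suc i) (Suc j)) (X i j)"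

lemma sq_at_transpose: "sq_at d L (\<lambda>i j. G j i) (\<lambda>i j. X j i) i j \<longleftrightarrow> sq_at d L G X j i"
  unfolding sq_at_def using sq_swap by blast

lemma column_edge_iff:
  assumes "0 < d" "G i 0 = G (Suc i) 0"
    and "\<And>j. j < m \<Longrightarrow> sq_at d L G X i j"
  shows "G i m \<noteq> G (Suc i) m \<longleftrightarrow> (\<exists>j<m. X i j)"
  using assms(3)
proof (induction m)
  case (Suc m)
  then have "G i (Suc m) \<noteq> G (Suc i) (Suc m) \<longleftrightarrow> G i m \<noteq> G (Suc i) m \<or> X i m"
    using sq_edge[OF _ assms(1)] unfolding sq_at_def by blast
  then show ?case using Suc by (auto simp: less_Suc_eq)
qed (use assms(2) in simp)

lemma row_edge_iff:
  assumes "0 < d" "G 0 j = G 0 (Suc j)"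
    and "\<And>i. i < m \<Longrightarrow> sq_at d L G X i j"
  shows "G m j \<noteq> G m (Suc j) \<longleftrightarrow> (\<exists>i<m. X i j)"
  using column_edge_iff[of d "\<lambda>i j. G j i" j m L "\<lambda>i j. X j i"] assms
  by (simp add: sq_at_transpose[of d L G X])

text \<open>A cross requires an edge without a box below it, but any earlier cross in the column has
  already put a box on that edge.\<close>

lemma column_cross_unique:
  assumes "0 < d" "G i 0 = G (Suc i) 0" "\<And>j. j < n \<Longrightarrow> sq_at d L G X i j"
    and "X i j" "X i j'" "j < n" "j' < n"
  shows "j = j'"
proof -
  have no: "\<not> X i l" if "X i k" "k < n" "l < k" for k l
  proof -
    have "G i k = G (Suc i) k" using assms(3)[of k] that sq_cross(1) by (auto simp: sq_at_def)
    then show ?thesis using column_edge_iff[of d G i k L X] assms(1-3) that by auto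
  qed
  show ?thesis using no[of j j'] no[of j' j] assms by (metis linorder_neqE_nat)
qed

text \<open>The edges at the lower left corner come from the boundary or from earlier squares. At a
  cross they carry no box, since a permutation has no other cross in that row or column, and
  avoidance makes the cross admissible.\<close>

lemma grow_sq_at:
  assumes p: "p \<in> avoiders n d L" and "0 < d" and "i < n" "j < n"
  shows "sq_at d L (grow d p) (\<lambda>i j. p (Suc i) = Suc j) i j"
  using assms(3,4)
proof (induction "i + j" arbitrary: i j rule: less_induct)
  case less
  let ?G = "grow d p" and ?X = "\<lambda>i j. p (Suc i) = Suc j"
  have perm: "p permutes {1..n}"
    and adm: "\<And>x. x \<in> {1..n} \<Longrightarrow> admissible d L (?G (x - 1) (p x - 1))"
    using p avoiders_iff_admissible[OF \<open>0 < d\<close>] by blast+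
  have col: "box_step d L (?G i j) (?G (Suc i) j)"
  proof (cases j)
    case 0
    then show ?thesis using cyl_part_replicate[OF \<open>0 < d\<close>] by (simp add: box_step_def)
  next
    case (Suc j')
    then have "sq_at d L ?G ?X i j'" using less by simp
    then show ?thesis using sq_box_step(4) \<open>0 < d\<close> Suc unfolding sq_at_def by blast
  qed
  have row: "box_step d L (?G i j) (?G i (Suc j))"
  proof (cases i)
    case 0
    then show ?thesis using cyl_part_replicate[OF \<open>0 < d\<close>] by (simp add: box_step_def)
  next
    case (Suc i')
    then have "sq_at d L ?G ?X i' j" using less by simp
    then show ?thesis using sq_box_step(3) \<open>0 < d\<close> Suc unfolding sq_at_def by blast
  qed
  have cross: "?G i j = ?G (Suc i) j \<and> ?G i j = ?G i (Suc j) \<and> admissible d L (?G i j)"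
    if X: "p (Suc i) = Suc j"
  proof (intro conjI)
    show "?G i j = ?G (Suc i) j"
      using column_edge_iff[of d ?G i j L ?X] less \<open>0 < d\<close> X by auto
    have "\<not> (\<exists>i'<i. p (Suc i') = Suc j)"
      using X permutes_inj[OF perm] by (metis injD less_irrefl nat.inject)
    then show "?G i j = ?G i (Suc j)"
      using row_edge_iff[of d ?G j i L ?X] less \<open>0 < d\<close> by auto
    show "admissible d L (?G i j)" using adm[of "Suc i"] less.prems X by simp
  qed
  obtain e where e: "sq d L (?G i j) (?G (Suc i) j) (?G i (Suc j)) e (?X i j)"
    using sq_fwd_exists[OF \<open>0 < d\<close> col row cross] by blast
  \<comment> \<open>The corner \<open>e\<close> was only known to exist; \<open>sq_fwd\<close>
    identifies it with the label computed by \<open>grow\<close>.\<close>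
  then show ?case using sq_fwd[OF e \<open>0 < d\<close>] by (simp add: sq_at_def)
qed

text \<open>\<open>bwd\<close> computes a label from the three others alone, so agreement spreads
  from the upper right boundary before anything is known about the crosses.\<close>

lemma sq_at_unique_from_boundary:
  assumes "0 < d"
    and G: "\<And>i j. i < n \<Longrightarrow> j < n \<Longrightarrow> sq_at d L G X i j"
    and H: "\<And>i j. i < n \<Longrightarrow> j < n \<Longrightarrow> sq_at d L H Y i j"
    and right: "\<And>j. j \<le> n \<Longrightarrow> G n j = H n j" and top: "\<And>i. i \<le> n \<Longrightarrow> G i n = H i n"
    and "i \<le> n" "j \<le> n"
  shows "G i j = H i j"
  using assms(6,7)
proof (induction "(n - i) + (n - j)" arbitrary: i j rule: less_induct)
  case less
  show ?case
  proof (cases "i = n \<or> j = n")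
    case True
    then show ?thesis using right top less.prems by auto
  next
    case False
    then have "i < n" "j < n" using less.prems by auto
    then have "G (Suc i) j = H (Suc i) j" "G i (Suc j) = H i (Suc j)"
      "G (Suc i) (Suc j) = H (Suc i) (Suc j)"
      by (auto intro!: less.hyps)
    then show ?thesis
      using sq_bwd[OF G[unfolded sq_at_def] \<open>0 < d\<close>] sq_bwd[OF H[unfolded sq_at_def] \<open>0 < d\<close>]
        \<open>i < n\<close> \<open>j < n\<close> by metis
  qed
qed

definition tableaux :: "nat \<Rightarrow> nat \<Rightarrow> (nat \<Rightarrow> nat) \<Rightarrow> nat list list \<times> nat list list" where
  "tableaux n d p = (map (grow d p n) [0..<Suc n], map (\<lambda>i. grow d p i n) [0..<Suc n])"

text \<open>Inverting \<open>p\<close> reflects the crosses in the diagonal, and the local rule is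
  symmetric in \<open>b\<close> and \<open>c\<close>.\<close>

lemma grow_inv:
  assumes "p permutes {1..n}"
  shows "grow d (inv p) i j = grow d p j i"
proof (induction "i + j" arbitrary: i j rule: less_induct)
  case less
  show ?case
  proof (cases "i = 0 \<or> j = 0")
    case True
    then show ?thesis by auto
  next
    case False
    then obtain i' j' where e: "i = Suc i'" "j = Suc j'" by (metis not0_implies_Suc)
    have "inv p (Suc i') = Suc j' \<longleftrightarrow> p (Suc j') = Suc i'"
      using permutes_inv_eq[OF assms] by metis
    then show ?thesis
      using less[of i' j'] less[of "Suc i'" j'] less[of i' "Suc j'"]
      by (simp add: e fwd_commute)
  qed
qed

lemma inv_in_avoiders:
  assumes "0 < d" and p: "p \<in> avoiders n d L"
  shows "inv p \<in> avoiders n d L"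
proof -
  have perm: "p permutes {1..n}" using p by (simp add: avoiders_def)
  have "admissible d L (grow d (inv p) (x - 1) (inv p x - 1))" if "x \<in> {1..n}" for x
  proof -
    have "inv p x \<in> {1..n}" using permutes_in_image[OF permutes_inv[OF perm]] that by blast
    then have "admissible d L (grow d p (inv p x - 1) (p (inv p x) - 1))"
      using p avoiders_iff_admissible[OF assms(1)] by blast
    then show ?thesis by (simp add: grow_inv[OF perm] permutes_inverses[OF perm])
  qed
  then show ?thesis using avoiders_iff_admissible[OF assms(1)] permutes_inv[OF perm] by blast
qed

lemma tableaux_inv:
  assumes "p permutes {1..n}" "tableaux n d p = (P, Q)"
  shows "tableaux n d (inv p) = (Q, P)"
proof -
  have "grow d (inv p) n = (\<lambda>i. grow d p i n)" "(\<lambda>i. grow d (inv p) i n) = grow d p n"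
    using grow_inv[OF assms(1)] by (simp_all add: fun_eq_iff)
  then show ?thesis using assms(2) unfolding tableaux_def by simp
qed

lemma nth_map_upt_Suc: "i \<le> n \<Longrightarrow> map f [0..<Suc n] ! i = f i"
  using nth_map_upt[of i "Suc n" 0 f] by simp

lemma grow_row_in_cylSYT:
  assumes "0 < n" "0 < d" "0 < L" and p: "p \<in> avoiders n d L"
  shows "map (grow d p n) [0..<Suc n] \<in> cylSYT n d L"
proof -
  let ?X = "\<lambda>i j. p (Suc i) = Suc j"
  have sq: "sq_at d L (grow d p) ?X i j" if "i < n" "j < n" for i j
    using grow_sq_at[OF p assms(2) that] .
  have perm: "p permutes {1..n}" using p by (simp add: avoiders_def)
  have "box_step d L (grow d p n j) (grow d p n (Suc j)) \<and> grow d p n j \<noteq> grow d p n (Suc j)"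
    if "j < n" for j
  proof
    obtain m where "n = Suc m" using \<open>0 < n\<close> by (cases n) auto
    then show "box_step d L (grow d p n j) (grow d p n (Suc j))"
      using sq[of m j] that sq_box_step(3) \<open>0 < d\<close> by (auto simp: sq_at_def simp del: grow.simps)
    \<comment> \<open>Surjectivity puts a cross into every row, so every step along the right
      boundary adds a box.\<close>
    have "Suc j \<in> p ` {1..n}" using permutes_image[OF perm] that by simp
    then obtain x where "x \<in> {1..n}" "p x = Suc j" by auto
    then have "x - 1 < n \<and> ?X (x - 1) j" by auto
    then show "grow d p n j \<noteq> grow d p n (Suc j)"
      using row_edge_iff[of d "grow d p" j n L ?X] \<open>0 < d\<close> sq that by auto
  qed
  then show ?thesis
    unfolding cylSYT_iff[OF assms(2,3)] by (simp add: nth_map_upt_Suc del: upt_Suc)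
qed

lemma tableaux_in_cylSYT:
  assumes "0 < n" "0 < d" "0 < L" and p: "p \<in> avoiders n d L" and t: "tableaux n d p = (P, Q)"
  shows "P \<in> cylSYT n d L" "Q \<in> cylSYT n d L" "shape P = shape Q"
proof -
  show "P \<in> cylSYT n d L"
    using grow_row_in_cylSYT[OF assms(1-4)] t by (simp add: tableaux_def del: upt_Suc)
  show "shape P = shape Q"
    using t by (auto simp: tableaux_def shape_def)
  have "map (grow d (inv p) n) [0..<Suc n] = Q"
    using tableaux_inv[OF _ t] p by (simp add: avoiders_def tableaux_def)
  then show "Q \<in> cylSYT n d L"
    using grow_row_in_cylSYT[OF assms(1-3) inv_in_avoiders[OF assms(2) p]] by simp
qed

text \<open>The boundary determines all labels, and then \<open>sq_bwd_cross\<close> determines the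
  crosses.\<close>

lemma inj_on_tableaux:
  assumes "0 < d"
  shows "inj_on (tableaux n d) (avoiders n d L)"
proof (rule inj_onI)
  fix p q assume p: "p \<in> avoiders n d L" and q: "q \<in> avoiders n d L"
    and eq: "tableaux n d p = tableaux n d q"
  have right: "grow d p n j = grow d q n j" and top: "grow d p j n = grow d q j n" if "j \<le> n" for j
    using eq that unfolding tableaux_def prod.inject by (metis nth_map_upt_Suc)+
  have G: "grow d p i j = grow d q i j" if "i \<le> n" "j \<le> n" for i j
    by (rule sq_at_unique_from_boundary[OF assms grow_sq_at[OF p assms] grow_sq_at[OF q assms]
          right top that])
  have perm: "p permutes {1..n}" "q permutes {1..n}" using p q by (auto simp: avoiders_def)
  show "p = q"
  proof
    fix x
    show "p x = q x"
    proof (cases "x \<in> {1..n}")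
      case True
      then have "p x \<in> {1..n}" using permutes_in_image[OF perm(1)] by blast
      then obtain i j where ij: "x = Suc i" "p x = Suc j" "i < n" "j < n"
        using True by (metis Suc_le_D Suc_le_lessD atLeastAtMost_iff One_nat_def)
      have "p (Suc i) = Suc j \<longleftrightarrow> q (Suc i) = Suc j"
        using sq_bwd_cross[OF grow_sq_at[OF p assms ij(3,4), unfolded sq_at_def] assms]
          sq_bwd_cross[OF grow_sq_at[OF q assms ij(3,4), unfolded sq_at_def] assms]
          G[of "Suc i" j] G[of i "Suc j"] G[of "Suc i" "Suc j"] ij(3,4)
        by (simp del: grow.simps)
      then show ?thesis using ij by simp
    next
      case False
      then show ?thesis using perm by (simp add: permutes_not_in)
    qed
  qed
qed

text \<open>Coordinates of \<open>shrink\<close> are distances from the upper right corner.\<close>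

fun shrink :: "nat \<Rightarrow> (nat \<Rightarrow> nat list) \<Rightarrow> (nat \<Rightarrow> nat list) \<Rightarrow> nat \<Rightarrow> nat \<Rightarrow> nat list" where
  "shrink d f g 0 v = f v"
| "shrink d f g (Suc u) 0 = g (Suc u)"
| "shrink d f g (Suc u) (Suc v) =
     bwd d (shrink d f g u (Suc v)) (shrink d f g (Suc u) v) (shrink d f g u v)"

text \<open>Labels are computed backwards by \<open>bwd\<close>; induction from the upper right
  corner shows that each square is legitimate, and its cross is then chosen.\<close>

lemma exists_diagram_with_boundary:
  assumes "0 < d" "0 < L"
    and P: "\<And>j. j < n \<Longrightarrow> box_step d L (P j) (P (Suc j))"
    and Q: "\<And>i. i < n \<Longrightarrow> box_step d L (Q i) (Q (Suc i))"
    and "P n = Q n"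
  obtains G X where "\<And>i j. i < n \<Longrightarrow> j < n \<Longrightarrow> sq_at d L G X i j"
    "\<And>j. j \<le> n \<Longrightarrow> G n j = P j" "\<And>i. i \<le> n \<Longrightarrow> G i n = Q i"
proof -
  define G where "G i j = shrink d (\<lambda>v. P (n - v)) (\<lambda>u. Q (n - u)) (n - i) (n - j)" for i j
  have right: "G n j = P j" if "j \<le> n" for j
    using that by (simp add: G_def)
  have top: "G i n = Q i" if "i \<le> n" for i
  proof (cases "n - i")
    case 0
    then show ?thesis using that \<open>P n = Q n\<close> by (simp add: G_def)
  next
    case (Suc u)
    then have "n - Suc u = i" using that by simp
    then show ?thesis using Suc by (simp add: G_def)
  qed
  have rec: "G i j = bwd d (G (Suc i) j) (G i (Suc j)) (G (Suc i) (Suc j))"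
    if "i < n" "j < n" for i j
    using that by (simp add: G_def flip: Suc_diff_Suc)
  have ex: "\<exists>X. sq d L (G i j) (G (Suc i) j) (G i (Suc j)) (G (Suc i) (Suc j)) X"
    if "i < n" "j < n" for i j
    using that
  proof (induction "(n - i) + (n - j)" arbitrary: i j rule: less_induct)
    case less
    have "box_step d L (G (Suc i) j) (G (Suc i) (Suc j))"
    proof (cases "Suc i = n")
      case True
      then show ?thesis using right P less.prems by simp
    next
      case False
      then show ?thesis using less.hyps[of "Suc i" j] less.prems sq_box_step(2) \<open>0 < d\<close> by fastforce
    qed
    moreover have "box_step d L (G i (Suc j)) (G (Suc i) (Suc j))"
    proof (cases "Suc j = n")
      case True
      then show ?thesis using top Q less.prems by simp
    next
      case False
      then show ?thesis using less.hyps[of i "Suc j"] less.prems sq_box_step(1) \<open>0 < d\<close> by fastforce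
    qed
    ultimately obtain a X where "sq d L a (G (Suc i) j) (G i (Suc j)) (G (Suc i) (Suc j)) X"
      using sq_bwd_exists[OF assms(1,2)] by blast
    \<comment> \<open>The corner \<open>a\<close> that completes the square must be the computed
      label, because \<open>sq_bwd\<close> leaves no choice.\<close>
    then show ?case using sq_bwd[OF _ \<open>0 < d\<close>] rec[OF less.prems] by metis
  qed
  then obtain X where "\<And>i j. i < n \<Longrightarrow> j < n \<Longrightarrow> sq_at d L G X i j"
    unfolding sq_at_def by metis
  then show thesis using that right top by blast
qed

text \<open>The tableaux are completed to a diagram; its crosses form a permutation, whose own
  growth diagram is the given one.\<close>

lemma surj_tableaux:
  assumes "0 < d" "0 < L" and "P \<in> cylSYT n d L" "Q \<in> cylSYT n d L" "shape P = shape Q"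
  shows "\<exists>p \<in> avoiders n d L. tableaux n d p = (P, Q)"
proof -
  note P = assms(3)[unfolded cylSYT_iff[OF assms(1,2)]]
  note Q = assms(4)[unfolded cylSYT_iff[OF assms(1,2)]]
  have "P ! n = Q ! n"
    using assms(5) P Q by (metis shape_def last_conv_nth diff_Suc_1 length_0_conv nat.distinct(1))
  then obtain G X where sq: "\<And>i j. i < n \<Longrightarrow> j < n \<Longrightarrow> sq_at d L G X i j"
    and right: "\<And>j. j \<le> n \<Longrightarrow> G n j = P ! j" and top: "\<And>i. i \<le> n \<Longrightarrow> G i n = Q ! i"
    using exists_diagram_with_boundary[OF assms(1,2), of n "\<lambda>j. P ! j" "\<lambda>i. Q ! i"] P Q by metis
  have bottom: "G i 0 = replicate d 0" if "i \<le> n" for i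
    using that
  proof (induction rule: inc_induct)
    case base
    then show ?case using right[of 0] P by simp
  next
    case (step m)
    then show ?case using sq[of m 0] sq_box_step(1) \<open>0 < d\<close> box_step_replicate
      unfolding sq_at_def by (metis gr_zeroI not_less_zero)
  qed
  have left: "G 0 j = replicate d 0" if "j \<le> n" for j
    using that
  proof (induction rule: inc_induct)
    case base
    then show ?case using top[of 0] Q by simp
  next
    case (step m)
    then show ?case using sq[of 0 m] sq_box_step(2) \<open>0 < d\<close> box_step_replicate
      unfolding sq_at_def by (metis gr_zeroI not_less_zero)
  qed
  \<comment> \<open>Every step of \<open>Q\<close> adds a box at the top of a column whose bottom
    edge carries none, so the column contains a cross.\<close>
  have ex: "\<exists>j<n. X i j" if "i < n" for i
    using column_edge_iff[of d G i n L X] \<open>0 < d\<close> bottom sq top Q that by simp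
  then obtain f where f: "\<And>i. i < n \<Longrightarrow> f i < n \<and> X i (f i)" by metis
  have f_iff: "f i = j \<longleftrightarrow> X i j" if "i < n" "j < n" for i j
    using column_cross_unique[of d G i n L X "f i" j] \<open>0 < d\<close> bottom sq f[OF that(1)] that by auto
  have inj: "i = i'" if "X i j" "X i' j" "i < n" "i' < n" "j < n" for i i' j
    using column_cross_unique[of d "\<lambda>i j. G j i" j n L "\<lambda>i j. X j i" i i'] \<open>0 < d\<close> left sq that
    by (simp add: sq_at_transpose[of d L G X])
  define p where "p x = (if x \<in> {1..n} then Suc (f (x - 1)) else x)" for x
  have p_iff: "p (Suc i) = Suc j \<longleftrightarrow> X i j" if "i < n" "j < n" for i j
    using f_iff[OF that] that by (simp add: p_def)
  have perm: "p permutes {1..n}"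
  proof (rule bij_imp_permutes)
    have "inj_on p {1..n}"
    proof (rule inj_onI)
      fix x y assume "x \<in> {1..n}" "y \<in> {1..n}" "p x = p y"
      then have "x - 1 = y - 1"
        using inj[of "x - 1" "f (x - 1)" "y - 1"] f[of "x - 1"] f[of "y - 1"] by (auto simp: p_def)
      then show "x = y" using \<open>x \<in> {1..n}\<close> \<open>y \<in> {1..n}\<close> by auto
    qed
    moreover have "p ` {1..n} \<subseteq> {1..n}" using f by (auto simp: p_def Suc_le_eq)
    ultimately show "bij_betw p {1..n} {1..n}"
      by (simp add: bij_betw_def endo_inj_surj)
  qed (auto simp: p_def)
  \<comment> \<open>Both diagrams have zero left and bottom boundary and the same crosses, so the
    forward rule makes them equal.\<close>
  have grow: "grow d p i j = G i j" if "i \<le> n" "j \<le> n" for i j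
    using that
  proof (induction "i + j" arbitrary: i j rule: less_induct)
    case less
    show ?case
    proof (cases "i = 0 \<or> j = 0")
      case True
      then show ?thesis using left bottom less.prems by auto
    next
      case False
      then obtain i' j' where e: "i = Suc i'" "j = Suc j'" by (metis not0_implies_Suc)
      then have lt: "i' < n" "j' < n" using less.prems by auto
      then show ?thesis
        using less.hyps[of i' j'] less.hyps[of "Suc i'" j'] less.hyps[of i' "Suc j'"]
          sq_fwd[OF sq[OF lt, unfolded sq_at_def] \<open>0 < d\<close>] p_iff[OF lt]
        by (simp add: e)
    qed
  qed
  \<comment> \<open>Each cross of the diagram sits in a square of the case \<open>cross\<close>,
    which includes admissibility; avoidance follows.\<close>
  have "admissible d L (grow d p (x - 1) (p x - 1))" if x: "x \<in> {1..n}" for x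
  proof -
    have "x - 1 < n" using x by auto
    then have "X (x - 1) (f (x - 1))" "f (x - 1) < n" "p x - 1 = f (x - 1)"
      using f x by (auto simp: p_def)
    then show ?thesis
      using sq[OF \<open>x - 1 < n\<close>, of "f (x - 1)"] sq_cross(3) grow[of "x - 1" "f (x - 1)"] \<open>x - 1 < n\<close>
      by (auto simp: sq_at_def)
  qed
  then have "p \<in> avoiders n d L"
    using perm avoiders_iff_admissible[OF \<open>0 < d\<close>] by blast
  moreover have "tableaux n d p = (P, Q)"
    unfolding tableaux_def prod.inject
    using P Q grow right top by (auto intro!: nth_equalityI simp: nth_map_upt_Suc less_Suc_eq_le simp del: upt_Suc)
  ultimately show ?thesis by blast
qed

theorem theorem1p1:
  fixes n d L :: nat
  assumes "n \<ge> 1" and "d \<ge> 1" and "L \<ge> 1"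
  shows "\<exists>\<Phi> :: (nat \<Rightarrow> nat) \<Rightarrow> nat list list \<times> nat list list.
    bij_betw \<Phi> (avoiders n d L)
      {(P, Q). P \<in> cylSYT n d L \<and> Q \<in> cylSYT n d L \<and> shape P = shape Q} \<and>
    (\<forall>\<pi> \<in> avoiders n d L. \<forall>P Q. \<Phi> \<pi> = (P, Q) \<longrightarrow> \<Phi> (inv \<pi>) = (Q, P))"
proof (intro exI[of _ "tableaux n d"] conjI ballI allI impI)
  have pos: "0 < n" "0 < d" "0 < L" using assms by auto
  show "bij_betw (tableaux n d) (avoiders n d L)
      {(P, Q). P \<in> cylSYT n d L \<and> Q \<in> cylSYT n d L \<and> shape P = shape Q}"
    unfolding bij_betw_def
  proof (intro conjI inj_on_tableaux set_eqI iffI)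
    fix t assume "t \<in> tableaux n d ` avoiders n d L"
    then obtain p where p: "p \<in> avoiders n d L" and t: "t = tableaux n d p" by blast
    obtain P Q where PQ: "tableaux n d p = (P, Q)" by (rule prod.exhaust)
    show "t \<in> {(P, Q). P \<in> cylSYT n d L \<and> Q \<in> cylSYT n d L \<and> shape P = shape Q}"
      using tableaux_in_cylSYT[OF pos p PQ] unfolding t PQ by blast
  next
    fix t assume "t \<in> {(P, Q). P \<in> cylSYT n d L \<and> Q \<in> cylSYT n d L \<and> shape P = shape Q}"
    then obtain P Q where t: "t = (P, Q)"
      and "P \<in> cylSYT n d L" "Q \<in> cylSYT n d L" "shape P = shape Q" by blast
    then obtain p where "p \<in> avoiders n d L" "tableaux n d p = (P, Q)"
      using surj_tableaux[OF pos(2,3)] by blast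
    then show "t \<in> tableaux n d ` avoiders n d L" unfolding t by force
  qed (rule pos)
next
  fix \<pi> P Q assume "\<pi> \<in> avoiders n d L" "tableaux n d \<pi> = (P, Q)"
  then show "tableaux n d (inv \<pi>) = (Q, P)"
    using tableaux_inv by (auto simp: avoiders_def)
qed

end
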